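(* Let $V$ be a Hilbert space over $\mathbb{K}=\mathbb{R}$ or $\mathbb{C}$, let $A_0$ be a densely defined skew-symmetric operator on $V$, let $A:=-A_0^*$, and let $(H_-,H_+,G_-,G_+)$ be a boundary quadruple for $A_0$. Let $B$ be an operator on $V$ such that $A_0\subset B$. The following assertions are equivalent: (i) $B$ generates a unitary $C_0$-group on $V$; (ii) there exists a unitary operator $\Phi\in\mathcal{L}(H_-,H_+)$ such that $B=A_\Phi$, i.e. $D(B)=\{w\in D(A):\Phi G_-w=G_+w\}$ and $Bw=Aw$ for all $w\in D(B)$.
   Context: Inner products are linear in the first argument (and conjugate-linear in the second if $\mathbb{K}=\mathbb{C}$). An operator $B$ on $V$ is a linear map $B:D(B)\to V$ defined on a linear subspace $D(B)\subset V$. $A_0\subset B$ means $D(A_0)\subset D(B)$ and $Bx=A_0x$ for $x\in D(A_0)$. $A_0$ is skew-symmetric if $\langle A_0u,v\rangle_V+\langle u,A_0v\rangle_V=0$ for all $u,v\in D(A_0)$. With $A:=-A_0^*$, $D(A)=D(A_0^* )$, one has $A_0\subset A$. A boundary quadruple $(H_-,H_+,G_-,G_+)$ for $A_0$ consists of pre-Hilbert spaces $H_-,H_+$ over $\mathbb{K}$ and surjective linear maps $G_-:D(A)\to H_-$, $G_+:D(A)\to H_+$ such that $\langle Au,v\rangle_V+\langle u,Av\rangle_V=\langle G_+u,G_+v\rangle_{H_+}-\langle G_-u,G_-v\rangle_{H_-}$ for all $u,v\in D(A)$, and $\ker G_-+\ker G_+=D(A)$. A unitary operator $\Phi:H_-\to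 H_+$ is a surjective linear isometry. A unitary $C_0$-group is a $C_0$-group $(U(t))_{t\in\mathbb{R}}$ of unitary operators on $V$. *)

theory Defs
  imports "HOL-Analysis.Analysis"
begin

text \<open>
  Scalar fields that are \<open>\<real>\<close> or \<open>\<complex>\<close>: real algebras with an embedding into the complex numbers
  that respects the real algebra structure and whose range is \<open>\<real>\<close> or all of \<open>\<complex>\<close>. The
  embedding is automatically injective, being a homomorphism of fields.
\<close>

class real_or_complex = real_field +
  fixes to_complex :: "'a \<Rightarrow> complex"
  assumes to_complex_add: "to_complex (x + y) = to_complex x + to_complex y"
    and to_complex_mult: "to_complex (x * y) = to_complex x * to_complex y"
    and to_complex_one: "to_complex 1 = 1"
    and to_complex_scaleR: "to_complex (r *\<^sub>R x) = r *\<^sub>R to_complex x"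
    and range_to_complex: "range to_complex = \<real> \<or> range to_complex = UNIV"

instantiation real :: real_or_complex
begin
definition to_complex_real :: "real \<Rightarrow> complex" where "to_complex_real = complex_of_real"
instance
  by standard (auto simp: to_complex_real_def Reals_def scaleR_conv_of_real)
end

instantiation complex :: real_or_complex
begin
definition to_complex_complex :: "complex \<Rightarrow> complex" where "to_complex_complex = id"
instance
  by standard (auto simp: to_complex_complex_def)
end

lemma inj_to_complex: "inj (to_complex :: 'a::real_or_complex \<Rightarrow> complex)"
proof (rule injI)
  fix x y :: 'a
  assume eq: "to_complex x = to_complex y"
  have "to_complex ((x - y) + y) = to_complex (x - y) + to_complex y"
    by (rule to_complex_add)
  then have zero: "to_complex (x - y) = 0"
    using eq by simp
  show "x = y"
  proof (rule ccontr)
    assume "x \<noteq> y"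
    then have "(x - y) * inverse (x - y) = 1" by simp
    then have "to_complex (x - y) * to_complex (inverse (x - y)) = 1"
      by (metis to_complex_mult to_complex_one)
    with zero show False by simp
  qed
qed

definition scalar_cnj :: "'a::real_or_complex \<Rightarrow> 'a" where
  "scalar_cnj z = (THE w. to_complex w = cnj (to_complex z))"

lemma to_complex_scalar_cnj: "to_complex (scalar_cnj z) = cnj (to_complex z)"
proof -
  have "cnj (to_complex z) \<in> range (to_complex :: 'a \<Rightarrow> complex)"
    using range_to_complex[where ?'a = 'a] by (metis Reals_cnj_iff UNIV_I rangeI)
  then obtain w :: 'a where "to_complex w = cnj (to_complex z)"
    by (metis rangeE)
  then show ?thesis
    unfolding scalar_cnj_def
    by (rule theI) (metis \<open>to_complex w = _\<close> inj_to_complex injD)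
qed

lemma scalar_cnj_real [simp]: "scalar_cnj (x :: real) = x"
  using to_complex_scalar_cnj[of x] by (simp add: to_complex_real_def)

lemma scalar_cnj_complex [simp]: "scalar_cnj (z :: complex) = cnj z"
  using to_complex_scalar_cnj[of z] by (simp add: to_complex_complex_def)

text \<open>
  Norm, metric and topology are those of the type class; \<open>norm_eq\<close> says that the norm is the one
  induced by the inner product, and it entails positive definiteness.
\<close>

locale pre_hilbert_space = vector_space scale
  for scale :: "'k::real_or_complex \<Rightarrow> 'v::real_normed_vector \<Rightarrow> 'v" +
  fixes inner :: "'v \<Rightarrow> 'v \<Rightarrow> 'k"
  assumes scale_of_real: "scale (of_real r) x = r *\<^sub>R x"
    and inner_add_left: "inner (x + y) z = inner x z + inner y z"
    and inner_scale_left: "inner (scale c x) y = c * inner x y"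
    and inner_commute: "inner y x = scalar_cnj (inner x y)"
    and norm_eq: "inner x x = of_real ((norm x)\<^sup>2)"

locale hilbert_space = pre_hilbert_space scale inner
  for scale :: "'k::real_or_complex \<Rightarrow> 'v::banach \<Rightarrow> 'v" and inner :: "'v \<Rightarrow> 'v \<Rightarrow> 'k"

lemma pre_hilbert_space_real_inner:
  "pre_hilbert_space (scaleR :: real \<Rightarrow> 'v::real_inner \<Rightarrow> 'v) Inner_Product.inner"
proof unfold_locales
  fix x y :: 'v
  show "Inner_Product.inner y x = scalar_cnj (Inner_Product.inner x y)"
    by (simp add: Inner_Product.inner_commute)
qed (simp_all add: Inner_Product.inner_add_left dot_square_norm scaleR_add_right scaleR_add_left)

lemma hilbert_space_complex:
  "hilbert_space ((*) :: complex \<Rightarrow> complex \<Rightarrow> complex) (\<lambda>x y. x * cnj y)"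
  by unfold_locales
    (simp_all add: algebra_simps scaleR_conv_of_real complex_norm_square flip: of_real_power)

definition linear_map_on ::
  "('k::field \<Rightarrow> 'a::ab_group_add \<Rightarrow> 'a) \<Rightarrow> ('k \<Rightarrow> 'b::ab_group_add \<Rightarrow> 'b) \<Rightarrow> 'a set \<Rightarrow> ('a \<Rightarrow> 'b) \<Rightarrow> bool"
where
  "linear_map_on s1 s2 S f \<longleftrightarrow>
     module.subspace s1 S \<and>
     (\<forall>x\<in>S. \<forall>y\<in>S. f (x + y) = f x + f y) \<and>
     (\<forall>c. \<forall>x\<in>S. f (s1 c x) = s2 c (f x))"

text \<open>
  An unbounded operator on a space is a partial function \<open>T\<close> with domain \<open>dom T\<close>, so that equality
  of operators includes equality of domains, and \<open>S \<subseteq>\<^sub>m T\<close> says that \<open>T\<close> extends \<open>S\<close>.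
\<close>

definition linear_operator :: "('k::field \<Rightarrow> 'v::ab_group_add \<Rightarrow> 'v) \<Rightarrow> ('v \<rightharpoonup> 'v) \<Rightarrow> bool" where
  "linear_operator s T \<longleftrightarrow> linear_map_on s s (dom T) (\<lambda>x. the (T x))"

definition densely_defined :: "('v::topological_space \<rightharpoonup> 'v) \<Rightarrow> bool" where
  "densely_defined T \<longleftrightarrow> closure (dom T) = UNIV"

definition skew_symmetric :: "('v \<Rightarrow> 'v \<Rightarrow> 'k::ab_group_add) \<Rightarrow> ('v \<rightharpoonup> 'v) \<Rightarrow> bool" where
  "skew_symmetric ip T \<longleftrightarrow>
     (\<forall>u\<in>dom T. \<forall>v\<in>dom T. ip (the (T u)) v + ip u (the (T v)) = 0)"

text \<open>The value of the adjoint is uniquely determined only if \<open>T\<close> is densely defined.\<close>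

definition adjoint_op :: "('v \<Rightarrow> 'v \<Rightarrow> 'k) \<Rightarrow> ('v \<rightharpoonup> 'v) \<Rightarrow> ('v \<rightharpoonup> 'v)" where
  "adjoint_op ip T = (\<lambda>v.
     if \<exists>f. \<forall>u\<in>dom T. ip (the (T u)) v = ip u f
     then Some (THE f. \<forall>u\<in>dom T. ip (the (T u)) v = ip u f)
     else None)"

definition uminus_op :: "('v \<rightharpoonup> 'v::ab_group_add) \<Rightarrow> ('v \<rightharpoonup> 'v)" where
  "uminus_op T = (\<lambda>x. map_option uminus (T x))"

text \<open>
  Boundary maps are total functions of which only the values on \<open>dom A\<close> matter.
\<close>

definition boundary_quadruple ::
  "('k::real_or_complex \<Rightarrow> 'v::real_normed_vector \<Rightarrow> 'v) \<Rightarrow> ('v \<Rightarrow> 'v \<Rightarrow> 'k) \<Rightarrow> ('v \<rightharpoonup> 'v) \<Rightarrow>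
   ('k \<Rightarrow> 'm::real_normed_vector \<Rightarrow> 'm) \<Rightarrow> ('m \<Rightarrow> 'm \<Rightarrow> 'k) \<Rightarrow>
   ('k \<Rightarrow> 'p::real_normed_vector \<Rightarrow> 'p) \<Rightarrow> ('p \<Rightarrow> 'p \<Rightarrow> 'k) \<Rightarrow>
   ('v \<Rightarrow> 'm) \<Rightarrow> ('v \<Rightarrow> 'p) \<Rightarrow> bool"
where
  "boundary_quadruple s ip A\<^sub>0 s\<^sub>m ip\<^sub>m s\<^sub>p ip\<^sub>p G\<^sub>m G\<^sub>p \<longleftrightarrow>
     (let A = uminus_op (adjoint_op ip A\<^sub>0) in
       pre_hilbert_space s\<^sub>m ip\<^sub>m \<and> pre_hilbert_space s\<^sub>p ip\<^sub>p \<and>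
       linear_map_on s s\<^sub>m (dom A) G\<^sub>m \<and> G\<^sub>m ` dom A = UNIV \<and>
       linear_map_on s s\<^sub>p (dom A) G\<^sub>p \<and> G\<^sub>p ` dom A = UNIV \<and>
       (\<forall>u\<in>dom A. \<forall>v\<in>dom A.
          ip (the (A u)) v + ip u (the (A v)) = ip\<^sub>p (G\<^sub>p u) (G\<^sub>p v) - ip\<^sub>m (G\<^sub>m u) (G\<^sub>m v)) \<and>
       {x + y | x y. x \<in> dom A \<and> G\<^sub>m x = 0 \<and> y \<in> dom A \<and> G\<^sub>p y = 0} = dom A)"

definition unitary_operator ::
  "('k::field \<Rightarrow> 'a::real_normed_vector \<Rightarrow> 'a) \<Rightarrow> ('k \<Rightarrow> 'b::real_normed_vector \<Rightarrow> 'b) \<Rightarrow> ('a \<Rightarrow> 'b) \<Rightarrow> bool"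
where
  "unitary_operator s1 s2 \<Phi> \<longleftrightarrow>
     Vector_Spaces.linear s1 s2 \<Phi> \<and> surj \<Phi> \<and> (\<forall>x. norm (\<Phi> x) = norm x)"

definition c0_group :: "('k::field \<Rightarrow> 'v::real_normed_vector \<Rightarrow> 'v) \<Rightarrow> (real \<Rightarrow> 'v \<Rightarrow> 'v) \<Rightarrow> bool" where
  "c0_group s U \<longleftrightarrow>
     (\<forall>t. Vector_Spaces.linear s s (U t) \<and> bounded_linear (U t)) \<and>
     U 0 = id \<and> (\<forall>t r. U (t + r) = U t \<circ> U r) \<and>
     (\<forall>x. continuous_on UNIV (\<lambda>t. U t x))"

definition generator :: "(real \<Rightarrow> 'v::real_normed_vector \<Rightarrow> 'v) \<Rightarrow> ('v \<rightharpoonup> 'v)" where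
  "generator U = (\<lambda>x.
     if \<exists>y. ((\<lambda>t. (U t x - x) /\<^sub>R t) \<longlongrightarrow> y) (at 0)
     then Some (Lim (at 0) (\<lambda>t. (U t x - x) /\<^sub>R t))
     else None)"

definition generates_unitary_c0_group ::
  "('k::field \<Rightarrow> 'v::real_normed_vector \<Rightarrow> 'v) \<Rightarrow> ('v \<rightharpoonup> 'v) \<Rightarrow> bool"
where
  "generates_unitary_c0_group s B \<longleftrightarrow>
     (\<exists>U. c0_group s U \<and> (\<forall>t. unitary_operator s s (U t)) \<and> B = generator U)"

definition boundary_restriction ::
  "('v \<rightharpoonup> 'v) \<Rightarrow> ('v \<Rightarrow> 'm) \<Rightarrow> ('v \<Rightarrow> 'p) \<Rightarrow> ('m \<Rightarrow> 'p) \<Rightarrow> ('v \<rightharpoonup> 'v)"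
where
  "boundary_restriction A G\<^sub>m G\<^sub>p \<Phi> = A |` {w \<in> dom A. \<Phi> (G\<^sub>m w) = G\<^sub>p w}"

end

theory Submission
  imports Defs
begin

text \<open>
  Passing to real parts of inner products turns everything into real Hilbert space theory; linearity
  over the scalar field is recovered from the fact that the scalars commute with all constructions.

  If \<open>\<Phi>\<close> is unitary, Green's identity and the joint surjectivity of \<open>(G\<^sub>m, G\<^sub>p)\<close> show that \<open>A\<^sub>\<Phi>\<close> is
  skew-adjoint, so \<open>A\<^sub>\<Phi>\<close> generates a unitary group by Stone's theorem. That theorem is obtained from the
  exponentials of the bounded skew operators \<open>(1/2s) ((1 - sB)\<^sup>-\<^sup>1 - (1 + sB)\<^sup>-\<^sup>1)\<close> as \<open>s\<close> tends to \<open>0\<close>.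

  Conversely, a generator \<open>B\<close> is skew-adjoint, so the pairs \<open>(G\<^sub>m u, G\<^sub>p u)\<close> with \<open>u \<in> D(B)\<close> form the graph
  of an isometry that is maximal among the neutral subspaces. Its domain and range are everything
  because \<open>H\<^sub>-\<close> and \<open>H\<^sub>+\<close> are automatically complete: \<open>1 - A\<close> is onto already on the kernel of \<open>G\<^sub>p\<close>,
  hence \<open>G\<^sub>p\<close> maps the closed subspace \<open>ker (1 - A)\<close> onto \<open>H\<^sub>+\<close>, and on it \<open>2 \<parallel>z\<parallel>\<^sup>2 \<le> \<parallel>G\<^sub>p z\<parallel>\<^sup>2\<close>.
\<close>

section \<open>Real inner products\<close>

text \<open>Both directions turn on the indefinite form \<open>ip\<^sub>p (G\<^sub>p u) (G\<^sub>p
  v) - ip\<^sub>m (G\<^sub>m u) (G\<^sub>m v)\<close>. If S contains the domain of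
  \<open>A\<^sub>0\<close>, a pair (v, g) that is skew-orthogonal to the graph of \<open>A\<close>
  restricted to S already lies in the graph of \<open>A\<close>. By Green's identity,
  skew-adjointness of the restriction therefore means that S is its own annihilator for this form.
  The obstacle is that the boundary spaces are only pre-Hilbert. A self-annihilating S gives an
  isometry whose domain has trivial orthogonal complement, and in an incomplete space this does not
  make the domain everything. Completeness thus has to be transferred from V first, and without
  continuity of the boundary maps: limits of boundary values are identified by pairing them in
  Green's identity with elements of prescribed boundary values. Real parts lose nothing as long as
  the test vectors form a scalar-invariant set, since testing with all multiples c u recovers the
  scalar-valued identity.\<close>

locale real_inner_form =
  fixes ip :: "'v::real_normed_vector \<Rightarrow> 'v \<Rightarrow> real"
  assumes ip_add_left: "ip (x + y) z = ip x z + ip y z"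
    and ip_scaleR_left: "ip (r *\<^sub>R x) y = r * ip x y"
    and ip_commute: "ip x y = ip y x"
    and ip_self: "ip x x = (norm x)\<^sup>2"
begin

lemma ip_add_right: "ip x (y + z) = ip x y + ip x z"
  by (metis ip_add_left ip_commute)

lemma ip_scaleR_right: "ip x (r *\<^sub>R y) = r * ip x y"
  by (metis ip_scaleR_left ip_commute)

lemma ip_zero_left [simp]: "ip 0 x = 0"
  using ip_scaleR_left[of 0 0 x] by simp

lemma ip_zero_right [simp]: "ip x 0 = 0"
  using ip_scaleR_right[of x 0 0] by simp

lemma ip_minus_left: "ip (- x) y = - ip x y"
  using ip_scaleR_left[of "-1" x y] by simp

lemma ip_minus_right: "ip x (- y) = - ip x y"
  using ip_scaleR_right[of x "-1" y] by simp

lemma ip_diff_left: "ip (x - y) z = ip x z - ip y z"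
  using ip_add_left[of x "- y" z] by (simp add: ip_minus_left)

lemma ip_diff_right: "ip x (y - z) = ip x y - ip x z"
  using ip_add_right[of x y "- z"] by (simp add: ip_minus_right)

lemmas ip_simps = ip_add_left ip_add_right ip_diff_left ip_diff_right
  ip_scaleR_left ip_scaleR_right ip_minus_left ip_minus_right

lemma norm_add_sq: "(norm (x + y))\<^sup>2 = (norm x)\<^sup>2 + 2 * ip x y + (norm y)\<^sup>2"
  using ip_commute[of x y] by (simp add: ip_simps flip: ip_self)

lemma norm_diff_sq: "(norm (x - y))\<^sup>2 = (norm x)\<^sup>2 - 2 * ip x y + (norm y)\<^sup>2"
  using ip_commute[of x y] by (simp add: ip_simps flip: ip_self)

lemma ip_polarization: "ip x y = ((norm (x + y))\<^sup>2 - (norm (x - y))\<^sup>2) / 4"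
  by (simp add: norm_add_sq norm_diff_sq)

lemma ip_eq_zero_of_minimal:
  assumes "\<And>t. (norm x)\<^sup>2 \<le> (norm (x - t *\<^sub>R y))\<^sup>2"
  shows "ip x y = 0"
proof (cases "y = 0")
  case False
  \<comment> \<open>This \<open>t\<close> minimises the quadratic
    \<open>(norm (x - t *\<^sub>R y))\<^sup>2\<close>; it is the coefficient of the projection of
    \<open>x\<close> onto the line through \<open>y\<close>.\<close>
  define t where "t = ip x y / (norm y)\<^sup>2"
  have "0 \<le> - 2 * t * ip x y + t\<^sup>2 * (norm y)\<^sup>2"
    using assms[of t] by (simp add: norm_diff_sq ip_simps power_mult_distrib)
  also have "\<dots> = - (ip x y)\<^sup>2 / (norm y)\<^sup>2"
    using False by (simp add: t_def field_simps power2_eq_square)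
  finally have "(ip x y)\<^sup>2 / (norm y)\<^sup>2 \<le> 0" by simp
  then show ?thesis
    using False by (simp add: divide_le_0_iff)
qed simp

lemma Cauchy_Schwarz: "\<bar>ip x y\<bar> \<le> norm x * norm y"
proof (cases "y = 0")
  case False
  define t where "t = ip x y / (norm y)\<^sup>2"
  have "0 \<le> (norm (x - t *\<^sub>R y))\<^sup>2" by simp
  also have "\<dots> = (norm x)\<^sup>2 - 2 * (t * ip x y) + t\<^sup>2 * (norm y)\<^sup>2"
    by (simp only: norm_diff_sq) (simp add: ip_simps power_mult_distrib)
  also have "\<dots> = (norm x)\<^sup>2 - (ip x y)\<^sup>2 / (norm y)\<^sup>2"
    using False by (simp add: t_def field_simps power2_eq_square)
  finally have "(ip x y)\<^sup>2 \<le> (norm x * norm y)\<^sup>2"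
    using False by (simp add: field_simps power_mult_distrib)
  then show ?thesis
    using abs_le_square_iff[of "ip x y" "norm x * norm y"] by simp
qed simp

sublocale bilin: bounded_bilinear ip
  by unfold_locales
    (auto simp: ip_simps intro!: exI[of _ 1] Cauchy_Schwarz)

lemma eq_zero_of_ip_dense:
  assumes "closure S = UNIV" and "\<And>u. u \<in> S \<Longrightarrow> ip u x = 0"
  shows "x = 0"
proof -
  have "closed {u. ip u x = 0}"
    by (intro closed_Collect_eq bilin.continuous_on continuous_intros)
  then have "closure S \<subseteq> {u. ip u x = 0}"
    using assms(2) by (intro closure_minimal) auto
  then have "ip x x = 0" using assms(1) by blast
  then show ?thesis by (simp add: ip_self)
qed

text \<open>The projection theorem, with completeness asked of \<open>M\<close> alone so that it
  also serves inside pre-Hilbert spaces. A minimising sequence for the distance from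
  \<open>x\<close> to \<open>M\<close> is Cauchy, and the residual at its limit is orthogonal to
  \<open>M\<close>.\<close>

lemma complete_subspace_eq_UNIV:
  assumes M: "subspace M" and "complete M"
    and perp: "\<And>y. (\<And>m. m \<in> M \<Longrightarrow> ip y m = 0) \<Longrightarrow> y = 0"
  shows "M = UNIV"
proof -
  have "x \<in> M" for x
  proof -
    define d where "d = (INF m\<in>M. (norm (x - m))\<^sup>2)"
    have bdd: "bdd_below ((\<lambda>m. (norm (x - m))\<^sup>2) ` M)"
      by (rule bdd_belowI[of _ 0]) auto
    have d_le: "d \<le> (norm (x - m))\<^sup>2" if "m \<in> M" for m
      unfolding d_def using bdd that by (rule cINF_lower)
    have "\<exists>m\<in>M. (norm (x - m))\<^sup>2 < d + inverse (Suc n)" for n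
    proof (rule ccontr)
      assume "\<not> ?thesis"
      then have "d + inverse (Suc n) \<le> d"
        unfolding d_def using subspace_0[OF M] by (intro cINF_greatest) (auto simp: not_less)
      moreover have "0 < inverse (real (Suc n))" by simp
      ultimately show False by linarith
    qed
    then obtain f where fM: "\<And>n. f n \<in> M"
      and f: "\<And>n. (norm (x - f n))\<^sup>2 < d + inverse (Suc n)"
      by metis
    have dist_f: "(norm (f i - f j))\<^sup>2 \<le> 2 * inverse (Suc i) + 2 * inverse (Suc j)" for i j
    proof -
      \<comment> \<open>Midpoints stay in \<open>M\<close>, hence are no closer to \<open>x\<close>
        than the infimum allows; the parallelogram law converts this into a bound on
        \<open>f i - f j\<close>.\<close>
      have "d \<le> (norm (x - (1/2) *\<^sub>R (f i + f j)))\<^sup>2"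
        using M fM by (intro d_le subspace_scale subspace_add) auto
      also have "x - (1/2) *\<^sub>R (f i + f j) = (1/2) *\<^sub>R ((x - f i) + (x - f j))"
        by (simp add: algebra_simps flip: scaleR_add_left)
      finally have "4 * d \<le> (norm ((x - f i) + (x - f j)))\<^sup>2"
        by (simp add: power_divide)
      moreover have "(norm ((x - f i) + (x - f j)))\<^sup>2 + (norm ((x - f j) - (x - f i)))\<^sup>2
          = 2 * (norm (x - f i))\<^sup>2 + 2 * (norm (x - f j))\<^sup>2"
        using ip_commute[of "x - f i"] by (simp only: norm_add_sq norm_diff_sq) simp
      ultimately show ?thesis using f[of i] f[of j] by simp
    qed
    have "Cauchy f"
    proof (rule CauchyI)
      fix e :: real assume "e > 0"
      then obtain N where N: "inverse (Suc N) < e\<^sup>2 / 4"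
        using reals_Archimedean[of "e\<^sup>2 / 4"] by auto
      have "norm (f i - f j) < e" if "i \<ge> N" "j \<ge> N" for i j
      proof -
        have "inverse (real (Suc k)) \<le> inverse (Suc N)" if "k \<ge> N" for k
          using that by (simp add: field_simps)
        from this[of i] this[of j] have "(norm (f i - f j))\<^sup>2 < e\<^sup>2"
          using dist_f[of i j] N \<open>i \<ge> N\<close> \<open>j \<ge> N\<close> by linarith
        then show ?thesis
          using \<open>e > 0\<close> by (simp add: power_less_imp_less_base)
      qed
      then show "\<exists>N. \<forall>i\<ge>N. \<forall>j\<ge>N. norm (f i - f j) < e" by blast
    qed
    with \<open>complete M\<close> fM obtain m where m: "m \<in> M" "f \<longlonglongrightarrow> m"
      unfolding complete_def by blast
    have "(norm (x - m))\<^sup>2 \<le> d + 0"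
    proof (rule LIMSEQ_le)
      show "(\<lambda>n. (norm (x - f n))\<^sup>2) \<longlonglongrightarrow> (norm (x - m))\<^sup>2"
        by (intro tendsto_intros m)
      show "(\<lambda>n. d + inverse (Suc n)) \<longlonglongrightarrow> d + 0"
        by (intro tendsto_intros LIMSEQ_inverse_real_of_nat)
    qed (use f less_imp_le in blast)
    then have "(norm (x - m))\<^sup>2 \<le> (norm (x - m - t *\<^sub>R v))\<^sup>2" if "v \<in> M" for v t
      using d_le[OF subspace_add[OF M m(1) subspace_scale[OF M that]], of t]
      \<open>(norm (x - m))\<^sup>2 \<le> d + 0\<close> by (simp only: diff_diff_eq)
    then have "ip (x - m) v = 0" if "v \<in> M" for v
      using that by (intro ip_eq_zero_of_minimal)
    then have "x - m = 0" by (rule perp)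
    then show "x \<in> M" using m(1) by simp
  qed
  then show ?thesis by blast
qed

end

locale real_hilbert_form = real_inner_form ip for ip :: "'v::banach \<Rightarrow> 'v \<Rightarrow> real"
begin

text \<open>The lower bound makes preimages of Cauchy sequences Cauchy, and the closed graph keeps
  their limits in \<open>D\<close>. So the range is complete, and \<open>perp\<close> rules out a
  proper subspace.\<close>

lemma surj_of_bounded_below:
  fixes F :: "'v \<Rightarrow> 'v"
  assumes D: "subspace D"
    and add: "\<And>x y. x \<in> D \<Longrightarrow> y \<in> D \<Longrightarrow> F (x + y) = F x + F y"
    and scale: "\<And>r x. x \<in> D \<Longrightarrow> F (r *\<^sub>R x) = r *\<^sub>R F x"
    and below: "\<And>x. x \<in> D \<Longrightarrow> norm x \<le> norm (F x)"
    and closed_graph: "\<And>f x y. (\<And>n. f n \<in> D) \<Longrightarrow> f \<longlonglongrightarrow> x \<Longrightarrow> (\<lambda>n. F (f n)) \<longlonglongrightarrow> y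
        \<Longrightarrow> x \<in> D \<and> F x = y"
    and perp: "\<And>y. (\<And>x. x \<in> D \<Longrightarrow> ip (F x) y = 0) \<Longrightarrow> y = 0"
  shows "F ` D = UNIV"
proof (rule complete_subspace_eq_UNIV)
  have diff: "F (x - y) = F x - F y" if "x \<in> D" "y \<in> D" for x y
    using add[of x "- y"] scale[of y "-1"] that subspace_neg[OF D] by simp
  show "subspace (F ` D)"
    unfolding subspace_def
  proof (intro conjI ballI allI)
    show "0 \<in> F ` D"
      using scale[of 0 0] subspace_0[OF D] by (intro image_eqI[of _ _ 0]) auto
  next
    fix x y assume "x \<in> F ` D" "y \<in> F ` D"
    then obtain a b where "a \<in> D" "b \<in> D" "x = F a" "y = F b" by blast
    then show "x + y \<in> F ` D"
      using add[of a b] subspace_add[OF D, of a b] by (intro image_eqI[of _ _ "a + b"]) simp_all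
  next
    fix r x assume "x \<in> F ` D"
    then obtain a where "a \<in> D" "x = F a" by blast
    then show "r *\<^sub>R x \<in> F ` D"
      using scale[of a r] subspace_scale[OF D, of a r]
      by (intro image_eqI[of _ _ "r *\<^sub>R a"]) simp_all
  qed
  show "complete (F ` D)"
    unfolding complete_def
  proof (intro allI impI, elim conjE)
    fix g :: "nat \<Rightarrow> 'v" assume g: "\<forall>n. g n \<in> F ` D" and "Cauchy g"
    have "\<forall>n. \<exists>a. a \<in> D \<and> g n = F a" using g by blast
    then obtain f where f: "\<And>n. f n \<in> D" "\<And>n. g n = F (f n)"
      using choice[of "\<lambda>n a. a \<in> D \<and> g n = F a"] by blast
    have "norm (f m - f n) \<le> norm (g m - g n)" for m n
      using below[OF subspace_diff[OF D f(1) f(1)]] by (simp add: f diff)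
    then have "Cauchy f"
      using \<open>Cauchy g\<close> unfolding Cauchy_iff by (meson le_less_trans)
    then obtain x where "f \<longlonglongrightarrow> x" using Cauchy_convergent convergentD by blast
    moreover obtain y where y: "g \<longlonglongrightarrow> y"
      using \<open>Cauchy g\<close> Cauchy_convergent convergentD by blast
    ultimately have "x \<in> D \<and> F x = y"
      using f(1) by (intro closed_graph) (auto simp flip: f(2))
    then show "\<exists>l\<in>F ` D. g \<longlonglongrightarrow> l" using y by blast
  qed
  show "y = 0" if "\<And>m. m \<in> F ` D \<Longrightarrow> ip y m = 0" for y
    using that by (intro perp) (metis imageI ip_commute)
qed

end

section \<open>Exponentials of bounded operators\<close>

lemma mean_value_estimate:
  fixes f :: "real \<Rightarrow> 'a::real_normed_vector"
  assumes "\<And>s. (f has_vector_derivative f' s) (at s)"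
    and "\<And>s. \<bar>s\<bar> \<le> \<bar>t\<bar> \<Longrightarrow> norm (f' s) \<le> C"
  shows "norm (f t - f 0) \<le> \<bar>t\<bar> * C"
proof -
  have "norm (f t - f 0) \<le> C * norm (t - 0)"
  proof (rule differentiable_bound[where S = "cball 0 \<bar>t\<bar>"])
    show "(f has_derivative (\<lambda>h. h *\<^sub>R f' s)) (at s within cball 0 \<bar>t\<bar>)" for s
      using assms(1)[of s] by (auto simp: has_vector_derivative_def intro: has_derivative_at_withinI)
    show "onorm (\<lambda>h. h *\<^sub>R f' s) \<le> C" if "s \<in> cball 0 \<bar>t\<bar>" for s
    proof (rule onorm_le)
      show "norm (h *\<^sub>R f' s) \<le> C * norm h" for h
        using mult_left_mono[OF assms(2)[of s] norm_ge_zero[of h]] that by (simp add: mult.commute)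
    qed
  qed auto
  then show ?thesis by (simp add: mult.commute)
qed

text \<open>An arbitrary sequence stands in for the iterates of an operator on a vector, so that
  differentiating in \<open>t\<close> is just a shift of the sequence.\<close>

definition exp_series :: "(nat \<Rightarrow> 'v::banach) \<Rightarrow> real \<Rightarrow> 'v" where
  "exp_series y t = (\<Sum>n. (t ^ n / fact n) *\<^sub>R y n)"

lemma summable_exp_series_bound: "summable (\<lambda>n. r ^ n / fact n * (C * K ^ n) :: real)"
proof -
  have "summable (\<lambda>n. C * (inverse (fact n) * (r * K) ^ n))"
    by (intro summable_mult summable_exp)
  then show ?thesis by (simp add: field_simps power_mult_distrib)
qed

lemma norm_exp_series_term:
  assumes "\<And>n. norm (y n) \<le> C * K ^ n" and "\<bar>t\<bar> \<le> r"
  shows "norm ((t ^ n / fact n) *\<^sub>R y n) \<le> r ^ n / fact n * (C * K ^ n)"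
  using assms by (auto simp: power_abs intro!: mult_mono divide_right_mono power_mono)

lemma summable_exp_series:
  fixes y :: "nat \<Rightarrow> 'v::banach"
  assumes "\<And>n. norm (y n) \<le> C * K ^ n"
  shows "summable (\<lambda>n. (t ^ n / fact n) *\<^sub>R y n)"
  by (rule summable_comparison_test'[OF summable_exp_series_bound])
    (rule norm_exp_series_term[OF assms order_refl])

lemma exp_series_has_vector_derivative:
  fixes y :: "nat \<Rightarrow> 'v::banach"
  assumes y: "\<And>n. norm (y n) \<le> C * K ^ n"
  shows "(exp_series y has_vector_derivative exp_series (\<lambda>n. y (Suc n)) t) (at t)"
proof -
  define S where "S = ball (0::real) (\<bar>t\<bar> + 1)"
  define f where "f n s = (s ^ n / fact n) *\<^sub>R y n" for n and s :: real
  \<comment> \<open>The term of index 0 is constant, so the differentiated series effectively starts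
    at index 1; reindexing it produces the series of the shifted sequence.\<close>
  define f' where "f' n s = (case n of 0 \<Rightarrow> 0 | Suc k \<Rightarrow> (s ^ k / fact k) *\<^sub>R y n)" for n and s :: real
  have y': "norm (y (Suc n)) \<le> (C * K) * K ^ n" for n
    using y[of "Suc n"] by (simp add: mult.assoc)
  have deriv: "(f n has_derivative (\<lambda>h. h *\<^sub>R f' n s)) (at s within S)" for n s
  proof (cases n)
    case 0
    then show ?thesis by (simp add: f_def[abs_def] f'_def)
  next
    case (Suc k)
    have "((\<lambda>s. s ^ Suc k / fact (Suc k)) has_vector_derivative (s ^ k / fact k)) (at s within S)"
      unfolding has_real_derivative_iff_has_vector_derivative[symmetric]
      by (rule derivative_eq_intros refl | simp add: divide_simps)+
    then have "((\<lambda>s. (s ^ Suc k / fact (Suc k)) *\<^sub>R y (Suc k)) has_vector_derivative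
        (s ^ k / fact k) *\<^sub>R y (Suc k)) (at s within S)"
      by (rule bounded_linear.has_vector_derivative[OF bounded_linear_scaleR_left])
    then show ?thesis
      by (simp add: Suc f_def[abs_def] f'_def has_vector_derivative_def)
  qed
  have uniform: "uniform_limit S (\<lambda>n s. \<Sum>i<n. f' i s) (\<lambda>s. \<Sum>i. f' i s) sequentially"
  proof (rule Weierstrass_m_test)
    define M where
      "M n = (case n of 0 \<Rightarrow> 0 | Suc k \<Rightarrow> (\<bar>t\<bar> + 1) ^ k / fact k * ((C * K) * K ^ k))" for n :: nat
    have "summable (\<lambda>n. M (Suc n))"
      unfolding M_def by (simp only: nat.case summable_exp_series_bound)
    then show "summable M" by (simp only: summable_Suc_iff)
    show "norm (f' n s) \<le> M n" if "s \<in> S" for n s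
      using norm_exp_series_term[of "\<lambda>n. y (Suc n)", OF y', of s "\<bar>t\<bar> + 1"] that
      by (auto simp: f'_def M_def S_def split: nat.split)
  qed
  have sum_f': "(\<Sum>i. f' i s) = exp_series (\<lambda>n. y (Suc n)) s" for s
  proof -
    have "summable (\<lambda>i. f' (Suc i) s)"
      using summable_exp_series[of "\<lambda>n. y (Suc n)", OF y'] by (simp add: f'_def)
    then have "summable (\<lambda>i. f' i s)"
      using summable_Suc_iff[of "\<lambda>i. f' i s"] by blast
    then have "(\<Sum>i. f' (Suc i) s) = (\<Sum>i. f' i s)"
      using suminf_split_head[of "\<lambda>i. f' i s"] by (simp add: f'_def)
    then show ?thesis by (simp add: f'_def exp_series_def)
  qed
  have "\<exists>g. \<forall>s\<in>S. (\<lambda>n. f n s) sums g s \<and>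
      (g has_derivative (\<lambda>h. h *\<^sub>R (\<Sum>i. f' i s))) (at s within S)"
  proof (rule has_derivative_series)
    show "convex S" by (simp add: S_def)
    show "\<forall>\<^sub>F n in sequentially. \<forall>s\<in>S. \<forall>h.
        norm ((\<Sum>i<n. h *\<^sub>R f' i s) - h *\<^sub>R (\<Sum>i. f' i s)) \<le> e * norm h" if "e > 0" for e
      using uniform_limitD[OF uniform that]
    proof (rule eventually_mono, intro ballI allI)
      fix n s and h :: real
      assume "\<forall>s\<in>S. dist (\<Sum>i<n. f' i s) (\<Sum>i. f' i s) < e" "s \<in> S"
      then have "norm ((\<Sum>i<n. f' i s) - (\<Sum>i. f' i s)) \<le> e"
        by (auto simp: dist_norm intro: less_imp_le)
      then show "norm ((\<Sum>i<n. h *\<^sub>R f' i s) - h *\<^sub>R (\<Sum>i. f' i s)) \<le> e * norm h"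
        using mult_right_mono[of "norm ((\<Sum>i<n. f' i s) - (\<Sum>i. f' i s))" e "norm h"]
        by (simp add: scaleR_right.sum[symmetric] scaleR_diff_right[symmetric] mult.commute)
    qed
    show "t \<in> S" by (simp add: S_def)
    show "(\<lambda>n. f n t) sums (\<Sum>n. f n t)"
      unfolding f_def by (rule summable_sums[OF summable_exp_series[OF y]])
  qed (rule deriv)
  then obtain g where g: "\<And>s. s \<in> S \<Longrightarrow> (\<lambda>n. f n s) sums g s"
    "\<And>s. s \<in> S \<Longrightarrow> (g has_derivative (\<lambda>h. h *\<^sub>R (\<Sum>i. f' i s))) (at s within S)"
    by blast
  have t: "t \<in> S" "open S" by (auto simp: S_def)
  have "(g has_vector_derivative exp_series (\<lambda>n. y (Suc n)) t) (at t)"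
    using g(2)[OF t(1)] by (simp only: at_within_open[OF t] sum_f' has_vector_derivative_def)
  then show ?thesis
  proof (rule has_vector_derivative_transform_within_open[where S = S])
    show "g s = exp_series y s" if "s \<in> S" for s
      using sums_unique[OF g(1)[OF that]] by (simp only: exp_series_def f_def)
  qed (use t in auto)
qed

definition op_exp :: "('v \<Rightarrow> 'v) \<Rightarrow> real \<Rightarrow> 'v::banach \<Rightarrow> 'v" where
  "op_exp T t x = exp_series (\<lambda>n. (T ^^ n) x) t"

lemma norm_funpow_le:
  fixes T :: "'v::real_normed_vector \<Rightarrow> 'v"
  assumes "bounded_linear T"
  shows "norm ((T ^^ n) x) \<le> norm x * onorm T ^ n"
proof (induction n)
  case (Suc n)
  have "norm (T ((T ^^ n) x)) \<le> onorm T * norm ((T ^^ n) x)"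
    by (rule onorm[OF assms])
  also have "\<dots> \<le> onorm T * (norm x * onorm T ^ n)"
    using Suc onorm_pos_le[OF assms] by (intro mult_left_mono)
  finally show ?case by (simp add: algebra_simps)
qed simp

lemma op_exp_0 [simp]: "op_exp T 0 x = x"
proof -
  have "(\<lambda>n. (0 ^ n / fact n) *\<^sub>R (T ^^ n) x) sums ((0 ^ 0 / fact 0) *\<^sub>R (T ^^ 0) x)"
    by (rule sums_single[THEN sums_cong[THEN iffD1, rotated]]) auto
  then show ?thesis
    by (simp add: op_exp_def exp_series_def sums_iff)
qed

text \<open>A bounded \<open>S\<close> passes through the series term by term. The case
  \<open>S = T\<close> puts the termwise derivative into the form of a differential
  equation.\<close>

lemma op_exp_commute:
  assumes "bounded_linear T" "bounded_linear S" and "\<And>x. S (T x) = T (S x)"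
  shows "S (op_exp T t x) = op_exp T t (S x)"
proof -
  have "S ((T ^^ n) x) = (T ^^ n) (S x)" for n
    by (induction n) (simp_all add: assms(3))
  then show ?thesis
    unfolding op_exp_def exp_series_def
    by (simp add: bounded_linear.suminf[OF assms(2) summable_exp_series[OF norm_funpow_le[OF assms(1)]]]
        linear_scale bounded_linear.linear[OF assms(2)])
qed

lemma op_exp_has_vector_derivative:
  assumes "bounded_linear T"
  shows "((\<lambda>t. op_exp T t x) has_vector_derivative T (op_exp T t x)) (at t)"
  unfolding op_exp_commute[OF assms assms refl]
  using exp_series_has_vector_derivative[OF norm_funpow_le[OF assms], of x t]
  by (simp add: op_exp_def[abs_def] funpow_swap1)

section \<open>Unitary groups\<close>

context real_hilbert_form
begin

text \<open>The derivative of \<open>ip (f t) (f t)\<close> is twice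
  \<open>ip (T (f t)) (f t)\<close>, which vanishes. Both the isometry of the exponentials and
  uniqueness of solutions come from this.\<close>

lemma norm_const_of_skew_ode:
  assumes f: "\<And>t. (f has_vector_derivative T (f t)) (at t)"
    and skew: "\<And>x. ip (T x) x = 0"
  shows "norm (f t) = norm (f 0)"
proof -
  have "((\<lambda>t. ip (f t) (f t)) has_vector_derivative ip (f t) (T (f t)) + ip (T (f t)) (f t)) (at t)" for t
    by (rule bilin.has_vector_derivative[OF f f])
  then have "((\<lambda>t. ip (f t) (f t)) has_vector_derivative 0) (at t)" for t
    using skew ip_commute by simp
  then have "ip (f t) (f t) = ip (f 0) (f 0)"
    using DERIV_isconst_all[of "\<lambda>t. ip (f t) (f t)" t 0]
    by (simp add: has_real_derivative_iff_has_vector_derivative)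
  then show ?thesis by (simp add: ip_self)
qed

end

locale bounded_skew = real_hilbert_form ip
  for ip :: "'v::banach \<Rightarrow> 'v \<Rightarrow> real" and T :: "'v \<Rightarrow> 'v" +
  assumes bounded: "bounded_linear T"
    and skew: "ip (T x) y = - ip x (T y)"
begin

sublocale T: bounded_linear T by (rule bounded)

lemma ip_T_self [simp]: "ip (T x) x = 0"
  using skew[of x x] ip_commute[of x "T x"] by simp

text \<open>The difference of two solutions is a solution, so its norm keeps its initial value 0.
  Additivity and the group law of the exponential follow by comparing solutions.\<close>

lemma ode_unique:
  assumes "\<And>t. (f has_vector_derivative T (f t)) (at t)"
    and "\<And>t. (g has_vector_derivative T (g t)) (at t)" and "f 0 = g 0"
  shows "f t = g t"
proof -
  have "((\<lambda>t. f t - g t) has_vector_derivative T (f t - g t)) (at t)" for t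
    unfolding T.diff by (rule has_vector_derivative_diff[OF assms(1,2)])
  then have "norm (f t - g t) = norm (f 0 - g 0)"
    by (rule norm_const_of_skew_ode[where f = "\<lambda>t. f t - g t"]) simp
  then show ?thesis using assms(3) by simp
qed

lemmas exp_deriv = op_exp_has_vector_derivative[OF bounded]

lemma norm_exp [simp]: "norm (op_exp T t x) = norm x"
  using norm_const_of_skew_ode[where f = "\<lambda>t. op_exp T t x", OF exp_deriv] by simp

lemma exp_linear: "linear (op_exp T t)"
proof (rule linearI)
  show "op_exp T t (x + y) = op_exp T t x + op_exp T t y" for x y
    by (rule ode_unique[of "\<lambda>t. op_exp T t (x + y)"])
      (auto simp: T.add intro!: has_vector_derivative_add exp_deriv)
  show "op_exp T t (r *\<^sub>R x) = r *\<^sub>R op_exp T t x" for r x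
    by (rule op_exp_commute[OF bounded bounded_linear_scaleR_right, symmetric])
      (simp add: T.scaleR)
qed

lemma exp_deriv_shift:
  "((\<lambda>t. op_exp T (t + c) x) has_vector_derivative T (op_exp T (t + c) x)) (at t)"
proof -
  have "((\<lambda>t. t + c) has_vector_derivative 1) (at t)"
    using has_vector_derivative_add[OF has_vector_derivative_id has_vector_derivative_const] by simp
  from vector_diff_chain_at[OF this exp_deriv, of x] show ?thesis by (simp add: o_def)
qed

lemma exp_add: "op_exp T (t + r) x = op_exp T t (op_exp T r x)"
  by (rule ode_unique[of "\<lambda>t. op_exp T (t + r) x"]) (auto intro: exp_deriv exp_deriv_shift)

lemma ip_exp: "ip (op_exp T t x) (op_exp T t y) = ip x y"
  by (simp add: ip_polarization linear_add[OF exp_linear, symmetric] linear_diff[OF exp_linear, symmetric])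

lemma norm_exp_diff_le: "norm (op_exp T t x - x) \<le> \<bar>t\<bar> * norm (T x)"
  using mean_value_estimate[where f = "\<lambda>t. op_exp T t x", OF exp_deriv, of t "norm (T x)"]
  by (simp add: op_exp_commute[OF bounded bounded refl])

text \<open>The bound involves \<open>T\<close> only through its action on \<open>x\<close>, not
  through its operator norm, so it can survive a limit of operators whose norms need not stay
  bounded.\<close>

lemma norm_exp_taylor_le:
  assumes "\<And>s. \<bar>s\<bar> \<le> \<bar>t\<bar> \<Longrightarrow> norm (op_exp T s (T x) - T x) \<le> C"
  shows "norm (op_exp T t x - x - t *\<^sub>R T x) \<le> \<bar>t\<bar> * C"
proof -
  have "((\<lambda>t. op_exp T t x - t *\<^sub>R T x) has_vector_derivative (op_exp T s (T x) - T x)) (at s)" for s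
    by (rule has_vector_derivative_diff)
      (use exp_deriv[of x s] in \<open>auto simp: op_exp_commute[OF bounded bounded refl] intro!: derivative_eq_intros\<close>)
  then have "norm ((op_exp T t x - t *\<^sub>R T x) - (op_exp T 0 x - 0 *\<^sub>R T x)) \<le> \<bar>t\<bar> * C"
    by (rule mean_value_estimate[where f = "\<lambda>t. op_exp T t x - t *\<^sub>R T x"]) (rule assms)
  then show ?thesis by (simp add: algebra_simps)
qed

end

text \<open>Duhamel's formula, tested against the difference \<open>y\<close> itself. Commutation
  moves \<open>T - S\<close> past the exponential onto \<open>x\<close>, so no operator norm enters;
  this is what makes the exponentials of the approximations a Cauchy sequence.\<close>

lemma norm_exp_diff_exp_le:
  assumes S: "bounded_skew ip S" and T: "bounded_skew ip T" and comm: "\<And>x. S (T x) = T (S x)"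
  shows "norm (op_exp T t x - op_exp S t x) \<le> \<bar>t\<bar> * norm (T x - S x)"
proof -
  interpret S: bounded_skew ip S by fact
  interpret T: bounded_skew ip T by fact
  define y where "y = op_exp T t x - op_exp S t x"
  \<comment> \<open>\<open>\<phi>\<close> interpolates between \<open>ip (op_exp S t x) y\<close> at \<open>0\<close> and \<open>ip (op_exp T t x) y\<close> at \<open>t\<close>\<close>
  define \<phi> where "\<phi> s = ip (op_exp T s x) (op_exp S (s - t) y)" for s
  have TS: "bounded_linear (\<lambda>x. T x - S x)"
    by (intro bounded_linear_sub S.bounded T.bounded)
  have \<phi>: "(\<phi> has_vector_derivative ip (op_exp T s (T x - S x)) (op_exp S (s - t) y)) (at s)" for s
  proof -
    have "((\<lambda>s. op_exp S (s - t) y) has_vector_derivative S (op_exp S (s - t) y)) (at s)"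
      using S.exp_deriv_shift[of "- t" y s] by simp
    from S.bilin.has_vector_derivative[OF T.exp_deriv this, of x]
    have "(\<phi> has_vector_derivative ip (op_exp T s x) (S (op_exp S (s - t) y))
        + ip (T (op_exp T s x)) (op_exp S (s - t) y)) (at s)"
      unfolding \<phi>_def[abs_def] .
    also have "ip (op_exp T s x) (S (op_exp S (s - t) y)) + ip (T (op_exp T s x)) (op_exp S (s - t) y)
        = ip (T (op_exp T s x) - S (op_exp T s x)) (op_exp S (s - t) y)"
      using S.skew by (simp add: S.ip_simps)
    also have "T (op_exp T s x) - S (op_exp T s x) = op_exp T s (T x - S x)"
      by (rule op_exp_commute[OF T.bounded TS]) (simp add: comm T.T.diff)
    finally show ?thesis .
  qed
  have "norm (\<phi> t - \<phi> 0) \<le> \<bar>t\<bar> * (norm (T x - S x) * norm y)"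
    using S.Cauchy_Schwarz[of "op_exp T s (T x - S x)" "op_exp S (s - t) y" for s]
    by (intro mean_value_estimate[OF \<phi>]) simp
  moreover have "\<phi> t - \<phi> 0 = (norm y)\<^sup>2"
  proof -
    have "\<phi> 0 = ip (op_exp S t x) (op_exp S t (op_exp S (- t) y))"
      unfolding S.ip_exp by (simp add: \<phi>_def)
    also have "op_exp S t (op_exp S (- t) y) = y"
      using S.exp_add[of t "- t" y] by simp
    finally show ?thesis
      by (simp add: \<phi>_def y_def S.ip_simps flip: S.ip_self)
  qed
  ultimately have "norm y * norm y \<le> (\<bar>t\<bar> * norm (T x - S x)) * norm y"
    by (simp add: power2_eq_square mult.assoc)
  then show ?thesis
    unfolding y_def[symmetric] by (cases "y = 0") auto
qed

section \<open>Skew-adjoint operators\<close>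

text \<open>Together, \<open>skew\<close> and \<open>maximal\<close> say that the adjoint of
  \<open>B\<close> is \<open>-B\<close>, domains included. Linearity and closedness of
  \<open>B\<close> are read off from \<open>maximal\<close>, because the defining identity is linear
  in \<open>(v, g)\<close> and stable under limits.\<close>

locale skew_adjoint = real_hilbert_form ip
  for ip :: "'v::banach \<Rightarrow> 'v \<Rightarrow> real" and D :: "'v set" and B :: "'v \<Rightarrow> 'v" +
  assumes dense: "closure D = UNIV"
    and skew: "x \<in> D \<Longrightarrow> y \<in> D \<Longrightarrow> ip (B x) y + ip x (B y) = 0"
    and maximal: "(\<And>u. u \<in> D \<Longrightarrow> ip (B u) v + ip u g = 0) \<Longrightarrow> v \<in> D \<and> B v = g"
begin

lemma add_D: "x + y \<in> D \<and> B (x + y) = B x + B y" if "x \<in> D" "y \<in> D"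
proof (rule maximal)
  show "ip (B u) (x + y) + ip u (B x + B y) = 0" if "u \<in> D" for u
    using skew[of u x] skew[of u y] that \<open>x \<in> D\<close> \<open>y \<in> D\<close> by (simp add: ip_simps)
qed

lemma scaleR_D: "r *\<^sub>R x \<in> D \<and> B (r *\<^sub>R x) = r *\<^sub>R B x" if "x \<in> D"
proof (rule maximal)
  show "ip (B u) (r *\<^sub>R x) + ip u (r *\<^sub>R B x) = 0" if "u \<in> D" for u
    using skew[of u x] that \<open>x \<in> D\<close> by (simp add: ip_simps flip: distrib_left)
qed

lemma diff_D: "x - y \<in> D \<and> B (x - y) = B x - B y" if "x \<in> D" "y \<in> D"
  using add_D[of x "- y"] scaleR_D[of y "-1"] that by simp

lemma subspace_D: "subspace D"
  using maximal[of 0 0] add_D scaleR_D by (simp add: subspace_def)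

lemma dense_approx:
  assumes "e > 0"
  obtains y where "y \<in> D" "norm (x - y) < e"
proof -
  have "x \<in> closure D" by (simp add: dense)
  then have "\<exists>y\<in>D. dist y x < e" using assms by (simp only: closure_approachable)
  then show thesis using that by (auto simp: dist_norm norm_minus_commute)
qed

lemma ip_B_self: "x \<in> D \<Longrightarrow> ip (B x) x = 0"
  using skew[of x x] ip_commute[of x "B x"] by simp

lemma closed_graph:
  assumes "\<And>n. f n \<in> D" "f \<longlonglongrightarrow> x" "(\<lambda>n. B (f n)) \<longlonglongrightarrow> y"
  shows "x \<in> D \<and> B x = y"
proof (rule maximal)
  fix u assume "u \<in> D"
  have "(\<lambda>n. ip (B u) (f n) + ip u (B (f n))) \<longlonglongrightarrow> ip (B u) x + ip u y"
    by (intro tendsto_intros bilin.tendsto assms)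
  then show "ip (B u) x + ip u y = 0"
    by (simp add: skew[OF \<open>u \<in> D\<close> assms(1)] LIMSEQ_const_iff)
qed

section \<open>Resolvents of a skew-adjoint operator\<close>

lemma norm_le_norm_resolvent: "norm x \<le> norm (x - s *\<^sub>R B x)" if "x \<in> D"
proof -
  have "(norm (x - s *\<^sub>R B x))\<^sup>2 = (norm x)\<^sup>2 + (norm (s *\<^sub>R B x))\<^sup>2"
    using ip_B_self[OF that] ip_commute[of x "B x"] by (simp only: norm_diff_sq) (simp add: ip_simps)
  then have "(norm x)\<^sup>2 \<le> (norm (x - s *\<^sub>R B x))\<^sup>2" by simp
  then show ?thesis by (simp add: power2_le_iff_abs_le)
qed

lemma surj_resolvent:
  assumes "s \<noteq> 0"
  shows "(\<lambda>x. x - s *\<^sub>R B x) ` D = UNIV"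
proof (rule surj_of_bounded_below)
  show "x + y - s *\<^sub>R B (x + y) = x - s *\<^sub>R B x + (y - s *\<^sub>R B y)" if "x \<in> D" "y \<in> D" for x y
    using add_D[OF that] by (simp add: algebra_simps)
  show "r *\<^sub>R x - s *\<^sub>R B (r *\<^sub>R x) = r *\<^sub>R (x - s *\<^sub>R B x)" if "x \<in> D" for r x
    using scaleR_D[OF that] by (simp add: algebra_simps)
  show "x \<in> D \<and> x - s *\<^sub>R B x = y"
    if "\<And>n. f n \<in> D" "f \<longlonglongrightarrow> x" "(\<lambda>n. f n - s *\<^sub>R B (f n)) \<longlonglongrightarrow> y" for f x y
  proof -
    have "(\<lambda>n. (1/s) *\<^sub>R (f n - (f n - s *\<^sub>R B (f n)))) \<longlonglongrightarrow> (1/s) *\<^sub>R (x - y)"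
      by (intro tendsto_intros that)
    then have "(\<lambda>n. B (f n)) \<longlonglongrightarrow> (1/s) *\<^sub>R (x - y)"
      using assms by simp
    then show ?thesis
      using closed_graph[OF that(1,2)] assms by fastforce
  qed
  show "y = 0" if "\<And>x. x \<in> D \<Longrightarrow> ip (x - s *\<^sub>R B x) y = 0" for y
  proof -
    \<comment> \<open>Orthogonality to the range makes \<open>y\<close> an eigenvector of
      \<open>B\<close> for the nonzero real eigenvalue \<open>- (1/s)\<close>, which skewness
      excludes unless \<open>y = 0\<close>.\<close>
    have "y \<in> D \<and> B y = - (1/s) *\<^sub>R y"
      using that assms by (intro maximal) (auto simp: ip_simps field_simps)
    then have "(norm y)\<^sup>2 = 0"
      using ip_B_self[of y] assms by (simp add: ip_simps ip_self)
    then show ?thesis by simp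
  qed
qed (use subspace_D norm_le_norm_resolvent in auto)

text \<open>The operator \<open>(1 - s B)^-1\<close>; in this scaling it is a contraction for every
  nonzero \<open>s\<close> of either sign and tends strongly to the identity as \<open>s\<close>
  tends to 0.\<close>

definition resolvent :: "real \<Rightarrow> 'v \<Rightarrow> 'v" where
  "resolvent s y = (SOME x. x \<in> D \<and> x - s *\<^sub>R B x = y)"

lemma resolvent: "resolvent s y \<in> D \<and> resolvent s y - s *\<^sub>R B (resolvent s y) = y" if "s \<noteq> 0"
proof -
  have "y \<in> (\<lambda>x. x - s *\<^sub>R B x) ` D" using surj_resolvent[OF that] by blast
  then have "\<exists>x. x \<in> D \<and> x - s *\<^sub>R B x = y" by blast
  then show ?thesis unfolding resolvent_def by (rule someI_ex)
qed

lemma resolvent_D: "s \<noteq> 0 \<Longrightarrow> resolvent s y \<in> D"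
  and resolvent_eq: "s \<noteq> 0 \<Longrightarrow> resolvent s y - s *\<^sub>R B (resolvent s y) = y"
  using resolvent by blast+

lemma resolvent_unique: "resolvent s y = x" if "s \<noteq> 0" "x \<in> D" "x - s *\<^sub>R B x = y"
proof -
  have "resolvent s y - x \<in> D \<and> B (resolvent s y - x) = B (resolvent s y) - B x"
    using resolvent_D[OF that(1)] that(2) by (intro diff_D)
  then have *: "resolvent s y - x \<in> D" "B (resolvent s y - x) = B (resolvent s y) - B x" by simp_all
  have "(resolvent s y - x) - s *\<^sub>R (B (resolvent s y) - B x) = 0"
  proof -
    have "(resolvent s y - x) - s *\<^sub>R (B (resolvent s y) - B x) = (resolvent s y - s *\<^sub>R B (resolvent s y)) - (x - s *\<^sub>R B x)"
      by (simp add: algebra_simps)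
    then show ?thesis by (simp only: resolvent_eq[OF that(1)] that(3) diff_self)
  qed
  then show ?thesis
    using norm_le_norm_resolvent[OF *(1), of s] unfolding *(2) by (metis eq_iff_diff_eq_0 norm_le_zero_iff norm_zero)
qed

lemma norm_resolvent: "s \<noteq> 0 \<Longrightarrow> norm (resolvent s y) \<le> norm y"
  using norm_le_norm_resolvent[OF resolvent_D[of s y], of s] resolvent_eq[of s y] by metis

lemma bounded_linear_resolvent: "bounded_linear (resolvent s)" if "s \<noteq> 0"
proof (rule bounded_linear_intro)
  show "resolvent s (x + y) = resolvent s x + resolvent s y" for x y
  proof (rule resolvent_unique[OF that])
    note x = resolvent_D[OF that, of x] resolvent_eq[OF that, of x] and y = resolvent_D[OF that, of y] resolvent_eq[OF that, of y]
    show "resolvent s x + resolvent s y \<in> D" using add_D x y by blast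
    have "resolvent s x + resolvent s y - s *\<^sub>R B (resolvent s x + resolvent s y)
        = (resolvent s x - s *\<^sub>R B (resolvent s x)) + (resolvent s y - s *\<^sub>R B (resolvent s y))"
      using add_D[OF x(1) y(1)] by (simp add: algebra_simps)
    then show "resolvent s x + resolvent s y - s *\<^sub>R B (resolvent s x + resolvent s y) = x + y"
      by (simp only: x y)
  qed
  show "resolvent s (r *\<^sub>R x) = r *\<^sub>R resolvent s x" for r x
  proof (rule resolvent_unique[OF that])
    note x = resolvent_D[OF that, of x] resolvent_eq[OF that, of x]
    show "r *\<^sub>R resolvent s x \<in> D" using scaleR_D x by blast
    have "r *\<^sub>R resolvent s x - s *\<^sub>R B (r *\<^sub>R resolvent s x) = r *\<^sub>R (resolvent s x - s *\<^sub>R B (resolvent s x))"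
      using scaleR_D[OF x(1)] by (simp add: algebra_simps)
    then show "r *\<^sub>R resolvent s x - s *\<^sub>R B (r *\<^sub>R resolvent s x) = r *\<^sub>R x"
      by (simp only: x)
  qed
  show "norm (resolvent s x) \<le> norm x * 1" for x using norm_resolvent[OF that] by simp
qed

lemma resolvent_commute:
  assumes "s \<noteq> 0" "bounded_linear S" and "\<And>x. x \<in> D \<Longrightarrow> S x \<in> D \<and> B (S x) = S (B x)"
  shows "S (resolvent s x) = resolvent s (S x)"
proof -
  interpret S: bounded_linear S by fact
  note x = resolvent_D[OF assms(1), of x] resolvent_eq[OF assms(1), of x]
  have "S (resolvent s x) - s *\<^sub>R B (S (resolvent s x)) = S (resolvent s x - s *\<^sub>R B (resolvent s x))"
    using assms(3)[OF x(1)] by (simp add: S.diff S.scaleR)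
  then show ?thesis
    using resolvent_unique[OF assms(1)] assms(3)[OF x(1)] x(2) by metis
qed

lemma B_resolvent: "B (resolvent s x) = resolvent s (B x)" if "s \<noteq> 0" "x \<in> D"
proof -
  note x = resolvent_D[OF that(1), of x] resolvent_eq[OF that(1), of x]
  have "s *\<^sub>R B (resolvent s x) = resolvent s x - x"
    using x(2) by (metis add_diff_cancel_right' diff_add_cancel add.commute)
  then have "B (resolvent s x) = (1/s) *\<^sub>R (resolvent s x - x)"
    using that(1) by (metis divide_self_if scaleR_one scaleR_scaleR times_divide_eq_left mult_1)
  \<comment> \<open>The resolvent equation expresses \<open>B (resolvent s x)\<close> through
    \<open>resolvent s x\<close> and \<open>x\<close>, both in \<open>D\<close>; hence
    \<open>B\<close> may be applied to the equation once more.\<close>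
  then have BD: "B (resolvent s x) \<in> D"
    using scaleR_D diff_D x(1) that(2) by simp
  have "B (resolvent s x) - s *\<^sub>R B (B (resolvent s x)) = B (resolvent s x - s *\<^sub>R B (resolvent s x))"
    using diff_D[OF x(1)] scaleR_D[OF BD, of s] by simp
  then have "resolvent s (B x) = B (resolvent s x)"
    by (intro resolvent_unique[OF that(1) BD]) (simp only: x(2))
  then show ?thesis ..
qed

text \<open>Since \<open>B\<close> is skew, the adjoint of \<open>(1 - s B)^-1\<close> is
  \<open>(1 + s B)^-1\<close>. This is why a difference of resolvents with opposite parameters is
  skew.\<close>

lemma ip_resolvent: "ip (resolvent s x) y = ip x (resolvent (- s) y)" if "s \<noteq> 0"
proof -
  note x = resolvent_D[OF that, of x] resolvent_eq[OF that, of x]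
  have y: "resolvent (- s) y \<in> D" "resolvent (- s) y + s *\<^sub>R B (resolvent (- s) y) = y"
    using resolvent_D[of "- s" y] resolvent_eq[of "- s" y] that by simp_all
  have "ip (resolvent s x) (resolvent (- s) y + s *\<^sub>R B (resolvent (- s) y)) = ip (resolvent s x - s *\<^sub>R B (resolvent s x)) (resolvent (- s) y)"
    using add.inverse_unique[OF skew[OF x(1) y(1)], symmetric] by (simp add: ip_simps)
  then show ?thesis by (simp only: x y)
qed

text \<open>For \<open>y\<close> in \<open>D\<close> the error \<open>resolvent s y - y\<close>
  equals \<open>s *\<^sub>R resolvent s (B y)\<close>, which is of order \<open>s\<close>.
  Contractivity and density of \<open>D\<close> carry the convergence over to every
  \<open>x\<close>.\<close>

lemma resolvent_tendsto:
  assumes s: "s \<longlonglongrightarrow> 0" and s0: "\<And>n. s n \<noteq> 0"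
  shows "(\<lambda>n. resolvent (s n) x) \<longlonglongrightarrow> x"
proof (rule LIMSEQ_I)
  fix e :: real assume "e > 0"
  then have "e / 3 > 0" by simp
  then obtain y where y: "y \<in> D" "norm (x - y) < e / 3"
    by (rule dense_approx)
  have "(\<lambda>n. \<bar>s n\<bar> * norm (B y)) \<longlonglongrightarrow> 0"
    by (rule tendsto_mult_left_zero[OF tendsto_rabs_zero[OF s]])
  then obtain N where N: "\<And>n. n \<ge> N \<Longrightarrow> \<bar>s n\<bar> * norm (B y) < e / 3"
    using LIMSEQ_D[OF _ \<open>e / 3 > 0\<close>, of "\<lambda>n. \<bar>s n\<bar> * norm (B y)" 0] by (auto simp: abs_mult)
  have "norm (resolvent (s n) x - x) < e" if "n \<ge> N" for n
  proof -
    have "resolvent (s n) y - y = s n *\<^sub>R resolvent (s n) (B y)"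
      using resolvent_eq[OF s0[of n], of y] B_resolvent[OF s0[of n] y(1)] by (metis diff_diff_eq2 add_diff_cancel_left')
    then have "norm (resolvent (s n) y - y) \<le> \<bar>s n\<bar> * norm (B y)"
      using norm_resolvent[OF s0, of n "B y"] by (simp add: mult_left_mono)
    moreover have "norm (resolvent (s n) x - resolvent (s n) y) \<le> norm (x - y)"
      using norm_resolvent[OF s0, of n "x - y"] bounded_linear_resolvent[OF s0, of n]
      by (simp add: linear_diff bounded_linear.linear)
    moreover have "norm (resolvent (s n) x - x)
        \<le> norm (resolvent (s n) x - resolvent (s n) y) + norm (resolvent (s n) y - y) + norm (x - y)"
      using norm_triangle_ineq[of "(resolvent (s n) x - resolvent (s n) y) + (resolvent (s n) y - y)" "y - x"]
        norm_triangle_ineq[of "resolvent (s n) x - resolvent (s n) y" "resolvent (s n) y - y"]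
      by (simp add: norm_minus_commute)
    ultimately show ?thesis using N[OF that] y(2) by linarith
  qed
  then show "\<exists>N. \<forall>n\<ge>N. norm (resolvent (s n) x - x) < e" by blast
qed

text \<open>
  A symmetrized Yosida approximation: unlike the usual one it is skew, so its exponentials are
  isometries for both signs of the time.
\<close>

definition yosida :: "nat \<Rightarrow> 'v \<Rightarrow> 'v" where
  "yosida n x = (real (Suc n) / 2) *\<^sub>R (resolvent (inverse (Suc n)) x - resolvent (- inverse (Suc n)) x)"

lemma bounded_linear_yosida: "bounded_linear (yosida n)"
  unfolding yosida_def[abs_def]
  by (intro bounded_linear_intros bounded_linear_sub bounded_linear_compose[OF bounded_linear_scaleR_right] bounded_linear_resolvent) auto

lemma bounded_skew_yosida: "bounded_skew ip (yosida n)"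
proof (intro bounded_skew.intro bounded_skew_axioms.intro real_hilbert_form_axioms)
  show "bounded_linear (yosida n)" by (rule bounded_linear_yosida)
  show "ip (yosida n x) y = - ip x (yosida n y)" for x y
    using ip_resolvent[of "inverse (Suc n)" x y] ip_resolvent[of "- inverse (Suc n)" x y]
    by (simp add: yosida_def ip_simps algebra_simps)
qed

text \<open>On \<open>D\<close> the resolvent differs from the identity by \<open>s\<close> times
  the resolvent of \<open>B x\<close>. Subtracting this for \<open>s\<close> and \<open>- s\<close>
  leaves a common factor \<open>s\<close>, which cancels \<open>Suc n\<close>; what remains is the
  mean of two contractions applied to \<open>B x\<close>.\<close>

lemma yosida_D: "yosida n x = (1/2) *\<^sub>R (resolvent (inverse (Suc n)) (B x) + resolvent (- inverse (Suc n)) (B x))"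
  if "x \<in> D"
proof -
  define s where "s = inverse (real (Suc n))"
  have s: "s \<noteq> 0" "- s \<noteq> 0" "real (Suc n) * s = 1" by (auto simp: s_def)
  have "resolvent s x - resolvent (- s) x = s *\<^sub>R (resolvent s (B x) + resolvent (- s) (B x))"
  proof -
    have "resolvent s x - s *\<^sub>R resolvent s (B x) = x" "resolvent (- s) x + s *\<^sub>R resolvent (- s) (B x) = x"
      using resolvent_eq[OF s(1), of x] resolvent_eq[OF s(2), of x] unfolding B_resolvent[OF s(1) that] B_resolvent[OF s(2) that] by simp_all
    then have "resolvent s x = x + s *\<^sub>R resolvent s (B x)" "resolvent (- s) x = x - s *\<^sub>R resolvent (- s) (B x)"
      by (metis diff_add_cancel, metis add_diff_cancel_right')
    then have "resolvent s x - resolvent (- s) x = (x + s *\<^sub>R resolvent s (B x)) - (x - s *\<^sub>R resolvent (- s) (B x))" by metis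
    then show ?thesis by (simp add: scaleR_right_distrib)
  qed
  then have "yosida n x = ((real (Suc n) * s) / 2) *\<^sub>R (resolvent s (B x) + resolvent (- s) (B x))"
    unfolding yosida_def s_def[symmetric] by simp
  then show ?thesis unfolding s(3) unfolding s_def .
qed

lemma norm_yosida_le: "norm (yosida n x) \<le> norm (B x)" if "x \<in> D"
proof -
  have "norm (resolvent (inverse (Suc n)) (B x) + resolvent (- inverse (Suc n)) (B x)) \<le> norm (B x) + norm (B x)"
    by (intro norm_triangle_mono norm_resolvent) auto
  then show ?thesis by (simp add: yosida_D[OF that])
qed

lemma yosida_tendsto: "(\<lambda>n. yosida n x) \<longlonglongrightarrow> B x" if "x \<in> D"
proof -
  have "(\<lambda>n. - inverse (real (Suc n))) \<longlonglongrightarrow> 0"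
    using tendsto_minus[OF LIMSEQ_inverse_real_of_nat] by simp
  then have "(\<lambda>n. resolvent (inverse (Suc n)) (B x)) \<longlonglongrightarrow> B x" "(\<lambda>n. resolvent (- inverse (Suc n)) (B x)) \<longlonglongrightarrow> B x"
    using LIMSEQ_inverse_real_of_nat by (intro resolvent_tendsto; simp)+
  then have "(\<lambda>n. (1/2) *\<^sub>R (resolvent (inverse (Suc n)) (B x) + resolvent (- inverse (Suc n)) (B x)))
      \<longlonglongrightarrow> (1/2) *\<^sub>R (B x + B x)"
    by (intro tendsto_intros)
  then show ?thesis
    by (simp add: yosida_D[OF that] flip: scaleR_left_distrib scaleR_2)
qed

lemma yosida_commute:
  assumes "bounded_linear S" and "\<And>x. x \<in> D \<Longrightarrow> S x \<in> D \<and> B (S x) = S (B x)"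
  shows "S (yosida n x) = yosida n (S x)"
  using resolvent_commute[OF _ assms, of "inverse (Suc n)" x] resolvent_commute[OF _ assms, of "- inverse (Suc n)" x]
  by (simp add: yosida_def linear_scale linear_diff bounded_linear.linear[OF assms(1)])

text \<open>This supplies the commutation hypothesis of \<open>norm_exp_diff_exp_le\<close>. It
  suffices that one approximation maps \<open>D\<close> to itself and commutes with \<open>B\<close>
  there.\<close>

lemma yosida_yosida_commute: "yosida m (yosida n x) = yosida n (yosida m x)"
proof (rule yosida_commute[OF bounded_linear_yosida])
  fix x assume x: "x \<in> D"
  let ?s = "inverse (real (Suc m))"
  have JD: "resolvent ?s x \<in> D" "resolvent (- ?s) x \<in> D"
    by (simp_all add: resolvent_D)
  from B_resolvent[of ?s x] B_resolvent[of "- ?s" x] scaleR_D[of "resolvent ?s x - resolvent (- ?s) x" "real (Suc m) / 2"]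
    diff_D[OF JD] x
  show "yosida m x \<in> D \<and> B (yosida m x) = yosida m (B x)"
    by (simp add: yosida_def del: of_nat_Suc)
qed

end

section \<open>Stone's theorem\<close>

lemma generator_eq_Some_iff:
  "generator U x = Some y \<longleftrightarrow> ((\<lambda>t. (U t x - x) /\<^sub>R t) \<longlongrightarrow> y) (at 0)"
proof
  show "((\<lambda>t. (U t x - x) /\<^sub>R t) \<longlongrightarrow> y) (at 0)" if "generator U x = Some y"
    using that tendsto_Lim[of "at (0::real)" "\<lambda>t. (U t x - x) /\<^sub>R t"]
    by (auto simp: generator_def split: if_splits)
  show "generator U x = Some y" if "((\<lambda>t. (U t x - x) /\<^sub>R t) \<longlongrightarrow> y) (at 0)"
    using that tendsto_Lim[OF _ that] by (auto simp: generator_def)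
qed

lemma generator_eq_Some_of_estimate:
  assumes "\<And>e. e > 0 \<Longrightarrow> \<exists>d>0. \<forall>t. \<bar>t\<bar> < d \<longrightarrow> norm (U t x - x - t *\<^sub>R y) \<le> \<bar>t\<bar> * e"
  shows "generator U x = Some y"
  unfolding generator_eq_Some_iff
proof (rule LIM_I)
  fix r :: real assume "r > 0"
  \<comment> \<open>Halving \<open>r\<close> turns the weak inequality of the hypothesis into the
    strict one required for a limit.\<close>
  then obtain d where d: "d > 0" "\<And>t. \<bar>t\<bar> < d \<Longrightarrow> norm (U t x - x - t *\<^sub>R y) \<le> \<bar>t\<bar> * (r / 2)"
    using assms[of "r / 2"] by auto
  have "norm ((U t x - x) /\<^sub>R t - y) < r" if "t \<noteq> 0" "\<bar>t\<bar> < d" for t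
  proof -
    have "(U t x - x) /\<^sub>R t - y = (U t x - x - t *\<^sub>R y) /\<^sub>R t"
      using that(1) by (simp add: scaleR_diff_right)
    then have "norm ((U t x - x) /\<^sub>R t - y) = norm (U t x - x - t *\<^sub>R y) / \<bar>t\<bar>"
      by (simp add: divide_inverse mult.commute)
    also have "\<dots> \<le> r / 2"
      using d(2)[OF that(2)] that(1) by (simp add: pos_divide_le_eq mult.commute)
    finally show ?thesis using \<open>r > 0\<close> by linarith
  qed
  then show "\<exists>s>0. \<forall>t. t \<noteq> 0 \<and> norm (t - 0) < s \<longrightarrow> norm ((U t x - x) /\<^sub>R t - y) < r"
    using d(1) by auto
qed

lemma has_vector_derivative_of_generator:
  assumes "generator U x = Some y" and "U 0 x = x"
  shows "((\<lambda>t. U t x) has_vector_derivative y) (at 0)"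
proof -
  have "((\<lambda>t. (U t x - x) /\<^sub>R t - y) \<longlongrightarrow> 0) (at 0)"
    using assms(1) by (simp add: generator_eq_Some_iff LIM_zero)
  then have "((\<lambda>t. norm ((U t x - x) /\<^sub>R t - y)) \<longlongrightarrow> 0) (at 0)"
    by (rule tendsto_norm_zero)
  moreover have "\<forall>\<^sub>F t in at 0. norm ((U t x - x) /\<^sub>R t - y) = norm (U t x - x - t *\<^sub>R y) / norm t"
  proof (rule eventually_at_filter[THEN iffD2], intro always_eventually allI impI)
    fix t :: real assume "t \<noteq> 0"
    then have "(U t x - x) /\<^sub>R t - y = (U t x - x - t *\<^sub>R y) /\<^sub>R t"
      by (simp add: scaleR_diff_right)
    then show "norm ((U t x - x) /\<^sub>R t - y) = norm (U t x - x - t *\<^sub>R y) / norm t"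
      by (simp add: divide_inverse mult.commute)
  qed
  ultimately have "((\<lambda>t. norm (U t x - x - t *\<^sub>R y) / norm t) \<longlongrightarrow> 0) (at 0)"
    by (rule Lim_transform_eventually)
  then show ?thesis
    using assms(2) by (simp add: has_vector_derivative_def has_derivative_at bounded_linear_scaleR_left)
qed

text \<open>By continuity the inequality extends from \<open>S\<close> to the test vector
  \<open>x\<close> itself, where it reads \<open>(norm x)\<^sup>2 \<le> K * norm x\<close>.\<close>

lemma (in real_inner_form) norm_le_of_ip_dense:
  assumes "closure S = UNIV" and "\<And>u. u \<in> S \<Longrightarrow> ip u x \<le> K * norm u" and "0 \<le> K"
  shows "norm x \<le> K"
proof (cases "x = 0")
  case False
  have "closed {u. ip u x \<le> K * norm u}"
    by (intro closed_Collect_le bilin.continuous_on continuous_intros)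
  then have "closure S \<subseteq> {u. ip u x \<le> K * norm u}"
    using assms(2) by (intro closure_minimal) auto
  then have "ip x x \<le> K * norm x" using assms(1) by blast
  then show ?thesis using False by (simp add: ip_self power2_eq_square)
qed (simp add: assms(3))

section \<open>Groups of isometries and their generators\<close>

locale unitary_group = real_hilbert_form ip
  for ip :: "'v::banach \<Rightarrow> 'v \<Rightarrow> real" and U :: "real \<Rightarrow> 'v \<Rightarrow> 'v" +
  assumes linear_U: "linear (U t)"
    and norm_U: "norm (U t x) = norm x"
    and U_0: "U 0 x = x"
    and U_add: "U (t + r) x = U t (U r x)"
    and U_continuous: "((\<lambda>t. U t x) \<longlongrightarrow> x) (at 0)"
begin

lemma ip_U: "ip (U t x) (U t y) = ip x y"
  by (simp add: ip_polarization norm_U linear_add[OF linear_U, symmetric] linear_diff[OF linear_U, symmetric])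

lemma U_minus: "U t (U (- t) x) = x"
  using U_add[of t "- t" x] by (simp add: U_0)

lemma ip_U_adjoint: "ip (U t x) y = ip x (U (- t) y)"
  using ip_U[of t x "U (- t) y"] by (simp add: U_minus)

lemma bounded_linear_U: "bounded_linear (U t)"
  using linear_U norm_U by (intro bounded_linear.intro) (auto simp: bounded_linear_axioms_def intro!: exI[of _ 1])

lemma generator_skew:
  assumes "generator U x = Some a" "generator U y = Some b"
  shows "ip a y + ip x b = 0"
proof -
  \<comment> \<open>This is the product-rule form of the difference quotient of
    \<open>ip (U t x) (U t y)\<close>, a function that is constant in \<open>t\<close>.\<close>
  have "((\<lambda>t. ip ((U t x - x) /\<^sub>R t) y + ip (U t x) ((U t y - y) /\<^sub>R t)) \<longlongrightarrow> ip a y + ip x b) (at 0)"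
    using assms by (intro tendsto_intros bilin.tendsto U_continuous) (auto simp: generator_eq_Some_iff)
  moreover have "ip ((U t x - x) /\<^sub>R t) y + ip (U t x) ((U t y - y) /\<^sub>R t) = 0" for t
    by (simp add: ip_simps ip_U algebra_simps)
  ultimately show ?thesis
    by (simp add: tendsto_const_iff)
qed

lemma generator_invariant:
  assumes "generator U x = Some y"
  shows "generator U (U s x) = Some (U s y)"
proof -
  have "((\<lambda>t. U s ((U t x - x) /\<^sub>R t)) \<longlongrightarrow> U s y) (at 0)"
    using assms by (intro bounded_linear.tendsto[OF bounded_linear_U]) (simp add: generator_eq_Some_iff)
  moreover have "U s ((U t x - x) /\<^sub>R t) = (U t (U s x) - U s x) /\<^sub>R t" for t
    using U_add[of s t x] U_add[of t s x]
    by (simp add: linear_scale[OF linear_U] linear_diff[OF linear_U] add.commute)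
  ultimately show ?thesis by (simp add: generator_eq_Some_iff)
qed

lemma U_has_vector_derivative:
  assumes "generator U x = Some y"
  shows "((\<lambda>t. U t x) has_vector_derivative U s y) (at s)"
proof -
  have "((\<lambda>t. t - s) has_vector_derivative 1) (at s)"
    using has_vector_derivative_diff[OF has_vector_derivative_id has_vector_derivative_const] by simp
  then have "((\<lambda>t. U (t - s) x) has_vector_derivative y) (at s)"
    using vector_diff_chain_at[of "\<lambda>t. t - s" 1 s "\<lambda>t. U t x" y]
      has_vector_derivative_of_generator[OF assms U_0] by (simp add: o_def)
  then have "((\<lambda>t. U s (U (t - s) x)) has_vector_derivative U s y) (at s)"
    by (rule bounded_linear.has_vector_derivative[OF bounded_linear_U])
  then show ?thesis by (simp flip: U_add)
qed

text \<open>
  Differentiating \<open>ip u (U t v) = ip (U (-t) u) v\<close> for \<open>u\<close> in the domain gives a first-order Taylor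
  estimate for \<open>U t v\<close> tested against a dense set, which avoids resolvents and integrals.
\<close>

lemma generator_maximal:
  assumes dense: "closure (dom (generator U)) = UNIV"
    and v: "\<And>u b. generator U u = Some b \<Longrightarrow> ip b v + ip u g = 0"
  shows "generator U v = Some g"
proof (rule generator_eq_Some_of_estimate)
  fix e :: real assume "e > 0"
  then obtain d where d: "d > 0" "\<And>t. t \<noteq> 0 \<Longrightarrow> \<bar>t\<bar> < d \<Longrightarrow> norm (U t g - g) < e"
    using LIM_D[OF U_continuous \<open>e > 0\<close>, of g] by auto
  have "norm (U t v - v - t *\<^sub>R g) \<le> \<bar>t\<bar> * e" if "\<bar>t\<bar> < d" for t
  proof (rule norm_le_of_ip_dense[OF dense])
    fix u assume "u \<in> dom (generator U)"
    then obtain b where u: "generator U u = Some b" by auto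
    have deriv: "((\<lambda>s. ip u (U s v - v - s *\<^sub>R g)) has_vector_derivative ip u (U s g - g)) (at s)" for s
    proof -
      have "((\<lambda>s. U (- s) u) has_vector_derivative - U (- s) b) (at s)"
        using vector_diff_chain_at[OF has_vector_derivative_minus[OF has_vector_derivative_id]
            U_has_vector_derivative[OF u], of s] by (simp add: o_def)
      then have "((\<lambda>s. ip (U (- s) u) v) has_vector_derivative ip (- U (- s) b) v) (at s)"
        by (rule bounded_linear.has_vector_derivative[OF bilin.bounded_linear_left])
      \<comment> \<open>The hypothesis on \<open>v\<close> is used at \<open>U (- s) u\<close>: the
        domain is invariant, and the generator takes the value \<open>U (- s) b\<close>
        there.\<close>
      moreover have "ip (- U (- s) b) v = ip u (U s g)"
        using v[OF generator_invariant[OF u, of "- s"]] ip_U_adjoint[of "- s" u g]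
        by (simp add: ip_simps)
      ultimately have "((\<lambda>s. ip u (U s v)) has_vector_derivative ip u (U s g)) (at s)"
        using ip_U_adjoint[of "- s" u v for s] by simp
      moreover have "((\<lambda>s. ip u v + s * ip u g) has_vector_derivative ip u g) (at s)"
        unfolding has_real_derivative_iff_has_vector_derivative[symmetric]
        by (auto intro!: derivative_eq_intros)
      ultimately have "((\<lambda>s. ip u (U s v) - (ip u v + s * ip u g)) has_vector_derivative
          ip u (U s g) - ip u g) (at s)"
        by (rule has_vector_derivative_diff)
      then show ?thesis by (simp add: ip_simps diff_diff_eq)
    qed
    have "norm (ip u (U t v - v - t *\<^sub>R g) - ip u (U 0 v - v - 0 *\<^sub>R g)) \<le> \<bar>t\<bar> * (norm u * e)"
    proof (rule mean_value_estimate[OF deriv])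
      fix s :: real assume "\<bar>s\<bar> \<le> \<bar>t\<bar>"
      then have "norm (U s g - g) \<le> e"
        using d(2)[of s] \<open>\<bar>t\<bar> < d\<close> \<open>e > 0\<close> by (cases "s = 0") (auto simp: U_0)
      then have "norm u * norm (U s g - g) \<le> norm u * e"
        by (rule mult_left_mono) simp
      then show "norm (ip u (U s g - g)) \<le> norm u * e"
        using Cauchy_Schwarz[of u "U s g - g"] by simp
    qed
    then show "ip u (U t v - v - t *\<^sub>R g) \<le> \<bar>t\<bar> * e * norm u"
      by (simp add: U_0 mult_ac)
  qed (use \<open>e > 0\<close> in simp)
  with d(1) show "\<exists>d>0. \<forall>t. \<bar>t\<bar> < d \<longrightarrow> norm (U t v - v - t *\<^sub>R g) \<le> \<bar>t\<bar> * e" by blast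
qed

end

section \<open>The group generated by a skew-adjoint operator\<close>

context skew_adjoint
begin

definition U :: "real \<Rightarrow> 'v \<Rightarrow> 'v" where
  "U t x = lim (\<lambda>n. op_exp (yosida n) t x)"

lemmas norm_exp_yosida = bounded_skew.norm_exp[OF bounded_skew_yosida]
  and linear_exp_yosida = bounded_skew.exp_linear[OF bounded_skew_yosida]

text \<open>Since the exponentials are isometries, replacing \<open>x\<close> by a nearby
  \<open>x'\<close> costs the same for every \<open>n\<close>. This makes density arguments uniform
  in the approximation.\<close>

lemma norm_exp_yosida_diff_le:
  "norm (op_exp (yosida n) t x - y) \<le> norm (x - x') + norm (op_exp (yosida n) t x' - y)"
proof -
  have "op_exp (yosida n) t x - op_exp (yosida n) t x' = op_exp (yosida n) t (x - x')"
    by (simp add: linear_diff[OF linear_exp_yosida])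
  then have "norm (op_exp (yosida n) t x - op_exp (yosida n) t x') = norm (x - x')"
    by (simp add: norm_exp_yosida)
  then show ?thesis
    using norm_triangle_ineq[of "op_exp (yosida n) t x - op_exp (yosida n) t x'" "op_exp (yosida n) t x' - y"] by simp
qed

lemma Cauchy_exp_yosida: "Cauchy (\<lambda>n. op_exp (yosida n) t x)"
proof (rule CauchyI)
  fix e :: real assume "e > 0"
  then have "e / 3 > 0" by simp
  then obtain x' where x': "x' \<in> D" "norm (x - x') < e / 3" by (rule dense_approx)
  have "Cauchy (\<lambda>n. t *\<^sub>R yosida n x')"
    by (intro LIMSEQ_imp_Cauchy[of _ "t *\<^sub>R B x'"] tendsto_intros yosida_tendsto x')
  then obtain N where N: "\<And>m n. m \<ge> N \<Longrightarrow> n \<ge> N \<Longrightarrow> norm (t *\<^sub>R yosida m x' - t *\<^sub>R yosida n x') < e / 3"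
    using CauchyD[OF _ \<open>e / 3 > 0\<close>] by blast
  have "norm (op_exp (yosida m) t x - op_exp (yosida n) t x) < e" if "m \<ge> N" "n \<ge> N" for m n
  proof -
    have "norm (op_exp (yosida m) t x' - op_exp (yosida n) t x') \<le> \<bar>t\<bar> * norm (yosida m x' - yosida n x')"
      using yosida_yosida_commute by (intro norm_exp_diff_exp_le[of ip] bounded_skew_yosida)
    also have "\<dots> = norm (t *\<^sub>R yosida m x' - t *\<^sub>R yosida n x')"
      by (simp only: scaleR_diff_right[symmetric] norm_scaleR)
    also have "\<dots> < e / 3" by (rule N[OF that])
    finally show ?thesis
      using norm_exp_yosida_diff_le[of m t x "op_exp (yosida n) t x" x']
        norm_exp_yosida_diff_le[of n t x "op_exp (yosida m) t x'" x'] x'(2)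
      by (simp add: norm_minus_commute)
  qed
  then show "\<exists>N. \<forall>m\<ge>N. \<forall>n\<ge>N. norm (op_exp (yosida m) t x - op_exp (yosida n) t x) < e" by blast
qed

lemma U_tendsto: "(\<lambda>n. op_exp (yosida n) t x) \<longlonglongrightarrow> U t x"
  unfolding U_def using Cauchy_exp_yosida Cauchy_convergent convergent_LIMSEQ_iff by blast

lemma norm_U: "norm (U t x) = norm x"
  using tendsto_norm[OF U_tendsto[of t x]] by (simp add: norm_exp_yosida LIMSEQ_const_iff)

lemma U_0: "U 0 x = x"
  using U_tendsto[of 0 x] by (simp add: LIMSEQ_const_iff)

text \<open>Commutation with \<open>B\<close> passes to resolvents, approximations, exponentials and
  finally to the limit. Taking scalar multiplication for \<open>S\<close> later gives linearity over
  the whole scalar field.\<close>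

lemma U_commute:
  assumes "bounded_linear S" and "\<And>x. x \<in> D \<Longrightarrow> S x \<in> D \<and> B (S x) = S (B x)"
  shows "S (U t x) = U t (S x)"
proof (rule LIMSEQ_unique)
  show "(\<lambda>n. S (op_exp (yosida n) t x)) \<longlonglongrightarrow> S (U t x)"
    by (rule bounded_linear.tendsto[OF assms(1) U_tendsto])
  have "S (op_exp (yosida n) t x) = op_exp (yosida n) t (S x)" for n
    using yosida_commute[OF assms] by (intro op_exp_commute[of "yosida n" S] bounded_linear_yosida assms(1))
  then show "(\<lambda>n. S (op_exp (yosida n) t x)) \<longlonglongrightarrow> U t (S x)"
    using U_tendsto by simp
qed

lemma linear_U: "linear (U t)"
proof (rule linearI)
  show "U t (x + y) = U t x + U t y" for x y
  proof (rule LIMSEQ_unique[OF U_tendsto])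
    show "(\<lambda>n. op_exp (yosida n) t (x + y)) \<longlonglongrightarrow> U t x + U t y"
      by (simp only: linear_add[OF linear_exp_yosida]) (intro tendsto_intros U_tendsto)
  qed
  show "U t (r *\<^sub>R x) = r *\<^sub>R U t x" for r x
    using U_commute[OF bounded_linear_scaleR_right] scaleR_D by simp
qed

lemma U_add: "U (t + r) x = U t (U r x)"
proof (rule LIMSEQ_unique[OF U_tendsto])
  \<comment> \<open>The inner exponential still depends on \<open>n\<close>; replacing it by its
    limit \<open>U r x\<close> is harmless because the outer one preserves the norm of the
    error.\<close>
  have "(\<lambda>n. op_exp (yosida n) t (op_exp (yosida n) r x - U r x)) \<longlonglongrightarrow> 0"
    by (rule tendsto_norm_zero_cancel, simp only: norm_exp_yosida)
      (rule tendsto_norm_zero[OF LIM_zero[OF U_tendsto]])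
  from tendsto_add[OF this U_tendsto[of t "U r x"]]
  show "(\<lambda>n. op_exp (yosida n) (t + r) x) \<longlonglongrightarrow> U t (U r x)"
    by (simp add: bounded_skew.exp_add[OF bounded_skew_yosida] linear_diff[OF linear_exp_yosida])
qed

lemma norm_exp_yosida_diff_self_le:
  "y \<in> D \<Longrightarrow> norm (op_exp (yosida n) s x - x) \<le> 2 * norm (x - y) + \<bar>s\<bar> * norm (B y)"
proof -
  assume "y \<in> D"
  have "norm (op_exp (yosida n) s y - y) \<le> \<bar>s\<bar> * norm (B y)"
    using bounded_skew.norm_exp_diff_le[OF bounded_skew_yosida, of n s y]
      mult_left_mono[OF norm_yosida_le[OF \<open>y \<in> D\<close>, of n], of "\<bar>s\<bar>"] by linarith
  moreover have "norm (op_exp (yosida n) s y - x) \<le> norm (op_exp (yosida n) s y - y) + norm (x - y)"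
    using norm_triangle_ineq[of "op_exp (yosida n) s y - y" "y - x"] by (simp add: norm_minus_commute)
  ultimately show ?thesis
    using norm_exp_yosida_diff_le[of n s x x y] by linarith
qed

lemma norm_U_diff_self_le:
  assumes "y \<in> D"
  shows "norm (U s x - x) \<le> 2 * norm (x - y) + \<bar>s\<bar> * norm (B y)"
proof (rule LIMSEQ_le_const2)
  show "(\<lambda>n. norm (op_exp (yosida n) s x - x)) \<longlonglongrightarrow> norm (U s x - x)"
    by (intro tendsto_intros U_tendsto)
qed (use norm_exp_yosida_diff_self_le[OF assms] in blast)

text \<open>The Taylor remainder is governed by how far the group moves \<open>B x\<close>. As
  \<open>B x\<close> need not lie in \<open>D\<close>, an auxiliary \<open>y\<close> in
  \<open>D\<close> approximates it.\<close>

lemma norm_U_taylor_le: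
  assumes "x \<in> D" "y \<in> D"
  shows "norm (U t x - x - t *\<^sub>R B x) \<le> \<bar>t\<bar> * (2 * norm (B x - y) + \<bar>t\<bar> * norm (B y))"
proof (rule LIMSEQ_le)
  show "(\<lambda>n. norm (op_exp (yosida n) t x - x - t *\<^sub>R yosida n x)) \<longlonglongrightarrow> norm (U t x - x - t *\<^sub>R B x)"
    by (intro tendsto_intros U_tendsto yosida_tendsto assms)
  show "(\<lambda>n. \<bar>t\<bar> * (2 * norm (yosida n x - y) + \<bar>t\<bar> * norm (B y)))
      \<longlonglongrightarrow> \<bar>t\<bar> * (2 * norm (B x - y) + \<bar>t\<bar> * norm (B y))"
    by (intro tendsto_intros yosida_tendsto assms)
  have "norm (op_exp (yosida n) t x - x - t *\<^sub>R yosida n x) \<le> \<bar>t\<bar> * (2 * norm (yosida n x - y) + \<bar>t\<bar> * norm (B y))" for n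
  proof (rule bounded_skew.norm_exp_taylor_le[OF bounded_skew_yosida])
    fix s :: real assume "\<bar>s\<bar> \<le> \<bar>t\<bar>"
    then have "\<bar>s\<bar> * norm (B y) \<le> \<bar>t\<bar> * norm (B y)" by (rule mult_right_mono) simp
    then show "norm (op_exp (yosida n) s (yosida n x) - yosida n x) \<le> 2 * norm (yosida n x - y) + \<bar>t\<bar> * norm (B y)"
      using norm_exp_yosida_diff_self_le[OF assms(2), of n s "yosida n x"] by linarith
  qed
  then show "\<exists>N. \<forall>n\<ge>N. norm (op_exp (yosida n) t x - x - t *\<^sub>R yosida n x)
      \<le> \<bar>t\<bar> * (2 * norm (yosida n x - y) + \<bar>t\<bar> * norm (B y))" by blast
qed

lemma approx_small:
  assumes "e > 0"
  obtains y d where "y \<in> D" "d > 0"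
    "\<And>t. \<bar>t\<bar> < d \<Longrightarrow> 2 * norm (x - y) + \<bar>t\<bar> * norm (B y) < e"
proof -
  have "e / 4 > 0" using assms by simp
  then obtain y where y: "y \<in> D" "norm (x - y) < e / 4" by (rule dense_approx)
  \<comment> \<open>Chosen so that the second summand stays at most \<open>e / 2\<close>; the added
    1 avoids division by zero when \<open>B y = 0\<close>.\<close>
  define d where "d = e / (2 * (norm (B y) + 1))"
  have pos: "norm (B y) + 1 > 0" by (simp add: add_nonneg_pos)
  have "2 * norm (x - y) + \<bar>t\<bar> * norm (B y) < e" if "\<bar>t\<bar> < d" for t
  proof -
    have "\<bar>t\<bar> * norm (B y) \<le> d * (norm (B y) + 1)"
      using that by (intro mult_mono) auto
    also have "\<dots> = e / 2" using pos by (simp add: d_def divide_simps)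
    finally show ?thesis using y(2) by linarith
  qed
  moreover have "d > 0" using assms pos by (simp add: d_def)
  ultimately show thesis using that y(1) by blast
qed

sublocale U: unitary_group ip U
proof (intro unitary_group.intro unitary_group_axioms.intro real_hilbert_form_axioms)
  show "((\<lambda>t. U t x) \<longlongrightarrow> x) (at 0)" for x
  proof (rule LIM_I)
    fix r :: real assume "r > 0"
    then obtain y d where y: "y \<in> D" "d > 0" "\<And>t. \<bar>t\<bar> < d \<Longrightarrow> 2 * norm (x - y) + \<bar>t\<bar> * norm (B y) < r"
      using approx_small[where x = x] by blast
    then show "\<exists>s>0. \<forall>t. t \<noteq> 0 \<and> norm (t - 0) < s \<longrightarrow> norm (U t x - x) < r"
      using le_less_trans[OF norm_U_diff_self_le[OF y(1)] y(3)] y(2) by auto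
  qed
qed (fact linear_U norm_U U_0 U_add)+

lemma generator_U: "generator U x = (if x \<in> D then Some (B x) else None)"
proof -
  have D: "generator U x = Some (B x)" if "x \<in> D" for x
  proof (rule generator_eq_Some_of_estimate)
    fix e :: real assume "e > 0"
    then obtain y d where y: "y \<in> D" "d > 0" "\<And>t. \<bar>t\<bar> < d \<Longrightarrow> 2 * norm (B x - y) + \<bar>t\<bar> * norm (B y) < e"
      using approx_small[where x = "B x"] by blast
    have "norm (U t x - x - t *\<^sub>R B x) \<le> \<bar>t\<bar> * e" if "\<bar>t\<bar> < d" for t
      using norm_U_taylor_le[OF \<open>x \<in> D\<close> y(1), of t]
        mult_left_mono[OF less_imp_le[OF y(3)[OF that]], of "\<bar>t\<bar>"] by linarith
    then show "\<exists>d>0. \<forall>t. \<bar>t\<bar> < d \<longrightarrow> norm (U t x - x - t *\<^sub>R B x) \<le> \<bar>t\<bar> * e"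
      using y(2) by blast
  qed
  \<comment> \<open>The generator is skew and extends \<open>B\<close>, so maximality of
    \<open>B\<close> leaves no room for a larger domain.\<close>
  have "x \<in> D" if "generator U x = Some y" for y
    using maximal[of x y] U.generator_skew[OF D that] by blast
  then show ?thesis using D by (cases "generator U x") auto
qed

end

section \<open>Boundary maps\<close>

text \<open>Identifies a strong limit from a weak one in a space whose completeness is still to be
  established: test \<open>b m - b n\<close> with \<open>b m - l\<close> and let \<open>n\<close>
  tend to infinity.\<close>

lemma (in real_inner_form) tendsto_of_Cauchy_weak:
  assumes "Cauchy b" and weak: "\<And>c. (\<lambda>n. ip (b n) c) \<longlonglongrightarrow> ip l c"
  shows "b \<longlonglongrightarrow> l"
proof (rule LIMSEQ_I)
  fix e :: real assume "e > 0"
  then obtain N where N: "\<And>m n. m \<ge> N \<Longrightarrow> n \<ge> N \<Longrightarrow> norm (b m - b n) < e / 2"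
    using CauchyD[OF assms(1), of "e / 2"] by auto
  have "norm (b m - l) < e" if "m \<ge> N" for m
  proof -
    have "ip (b m - l) (b m - l) \<le> e / 2 * norm (b m - l)"
    proof (rule LIMSEQ_le_const2)
      show "(\<lambda>n. ip (b m - b n) (b m - l)) \<longlonglongrightarrow> ip (b m - l) (b m - l)"
        unfolding ip_diff_left by (intro tendsto_intros weak)
      have "ip (b m - b n) (b m - l) \<le> e / 2 * norm (b m - l)" if "n \<ge> N" for n
        using Cauchy_Schwarz[of "b m - b n" "b m - l"]
          mult_right_mono[OF less_imp_le[OF N[OF \<open>m \<ge> N\<close> that]] norm_ge_zero[of "b m - l"]]
        by linarith
      then show "\<exists>M. \<forall>n\<ge>M. ip (b m - b n) (b m - l) \<le> e / 2 * norm (b m - l)" by blast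
    qed
    then have "norm (b m - l) * norm (b m - l) \<le> e / 2 * norm (b m - l)"
      by (simp add: ip_self power2_eq_square)
    then have "norm (b m - l) \<le> e / 2"
      using \<open>e > 0\<close> by (cases "b m = l") auto
    then show ?thesis using \<open>e > 0\<close> by linarith
  qed
  then show "\<exists>N. \<forall>n\<ge>N. norm (b n - l) < e" by blast
qed

text \<open>\<open>A_iff\<close> is the graph of the negative adjoint of \<open>A\<^sub>0\<close> in
  real form. The last two assumptions merge surjectivity of the boundary maps with the kernel
  decomposition: each boundary value is attained with the opposite one equal to 0.\<close>

locale boundary_maps = real_hilbert_form ip + M: real_inner_form ip\<^sub>m + P: real_inner_form ip\<^sub>p
  for ip :: "'v::banach \<Rightarrow> 'v \<Rightarrow> real"
    and ip\<^sub>m :: "'m::real_normed_vector \<Rightarrow> 'm \<Rightarrow> real"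
    and ip\<^sub>p :: "'p::real_normed_vector \<Rightarrow> 'p \<Rightarrow> real" +
  fixes D\<^sub>0 :: "'v set" and A\<^sub>0 :: "'v \<Rightarrow> 'v" and D :: "'v set" and A :: "'v \<Rightarrow> 'v"
    and G\<^sub>m :: "'v \<Rightarrow> 'm" and G\<^sub>p :: "'v \<Rightarrow> 'p"
  assumes D\<^sub>0_dense: "closure D\<^sub>0 = UNIV"
    and A_iff: "v \<in> D \<and> A v = g \<longleftrightarrow> (\<forall>u\<in>D\<^sub>0. ip (A\<^sub>0 u) v + ip u g = 0)"
    and D\<^sub>0_D: "u \<in> D\<^sub>0 \<Longrightarrow> u \<in> D \<and> A u = A\<^sub>0 u"
    and G\<^sub>m_add: "u \<in> D \<Longrightarrow> v \<in> D \<Longrightarrow> G\<^sub>m (u + v) = G\<^sub>m u + G\<^sub>m v"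
    and G\<^sub>p_add: "u \<in> D \<Longrightarrow> v \<in> D \<Longrightarrow> G\<^sub>p (u + v) = G\<^sub>p u + G\<^sub>p v"
    and G\<^sub>m_scaleR: "u \<in> D \<Longrightarrow> G\<^sub>m (r *\<^sub>R u) = r *\<^sub>R G\<^sub>m u"
    and G\<^sub>p_scaleR: "u \<in> D \<Longrightarrow> G\<^sub>p (r *\<^sub>R u) = r *\<^sub>R G\<^sub>p u"
    and green: "u \<in> D \<Longrightarrow> v \<in> D \<Longrightarrow>
      ip (A u) v + ip u (A v) = ip\<^sub>p (G\<^sub>p u) (G\<^sub>p v) - ip\<^sub>m (G\<^sub>m u) (G\<^sub>m v)"
    and G\<^sub>m_ker: "\<exists>w\<in>D. G\<^sub>p w = 0 \<and> G\<^sub>m w = a"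
    and G\<^sub>p_ker: "\<exists>w\<in>D. G\<^sub>m w = 0 \<and> G\<^sub>p w = b"
begin

lemma A_D: "v \<in> D \<Longrightarrow> u \<in> D\<^sub>0 \<Longrightarrow> ip (A\<^sub>0 u) v + ip u (A v) = 0"
  using A_iff[of v "A v"] by simp

lemma D_A: "(\<And>u. u \<in> D\<^sub>0 \<Longrightarrow> ip (A\<^sub>0 u) v + ip u g = 0) \<Longrightarrow> v \<in> D \<and> A v = g"
  using A_iff[of v g] by simp

lemma add_D: "x + y \<in> D \<and> A (x + y) = A x + A y" if "x \<in> D" "y \<in> D"
proof (rule D_A)
  show "ip (A\<^sub>0 u) (x + y) + ip u (A x + A y) = 0" if "u \<in> D\<^sub>0" for u
    using A_D[OF \<open>x \<in> D\<close> that] A_D[OF \<open>y \<in> D\<close> that] by (simp add: ip_simps)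
qed

lemma scaleR_D: "r *\<^sub>R x \<in> D \<and> A (r *\<^sub>R x) = r *\<^sub>R A x" if "x \<in> D"
proof (rule D_A)
  show "ip (A\<^sub>0 u) (r *\<^sub>R x) + ip u (r *\<^sub>R A x) = 0" if "u \<in> D\<^sub>0" for u
    using A_D[OF \<open>x \<in> D\<close> that] by (simp add: ip_simps flip: distrib_left)
qed

lemma diff_D:
  assumes "x \<in> D" "y \<in> D"
  shows "x - y \<in> D" "A (x - y) = A x - A y" "G\<^sub>m (x - y) = G\<^sub>m x - G\<^sub>m y" "G\<^sub>p (x - y) = G\<^sub>p x - G\<^sub>p y"
proof -
  have y: "- y \<in> D" "A (- y) = - A y" using scaleR_D[OF assms(2), of "-1"] by simp_all
  then show "x - y \<in> D" "A (x - y) = A x - A y" using add_D[OF assms(1) y(1)] by simp_all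
  show "G\<^sub>m (x - y) = G\<^sub>m x - G\<^sub>m y" "G\<^sub>p (x - y) = G\<^sub>p x - G\<^sub>p y"
    using G\<^sub>m_add[OF assms(1) y(1)] G\<^sub>m_scaleR[OF assms(2), of "-1"]
      G\<^sub>p_add[OF assms(1) y(1)] G\<^sub>p_scaleR[OF assms(2), of "-1"] by simp_all
qed

lemma subspace_D: "subspace D"
  using D_A[of 0 0] add_D scaleR_D by (simp add: subspace_def)

lemma boundary_lift: "\<exists>w\<in>D. G\<^sub>m w = a \<and> G\<^sub>p w = b"
proof -
  obtain x y where "x \<in> D" "G\<^sub>p x = 0" "G\<^sub>m x = a" "y \<in> D" "G\<^sub>m y = 0" "G\<^sub>p y = b"
    using G\<^sub>m_ker G\<^sub>p_ker by meson
  then show ?thesis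
    using add_D[of x y] G\<^sub>m_add[of x y] G\<^sub>p_add[of x y] by (intro bexI[of _ "x + y"]) simp_all
qed

text \<open>Changing the sign of the operator changes the sign of Green's identity and so exchanges
  the boundary spaces; each result about one side thereby yields its mirror image.\<close>

lemma swap: "boundary_maps ip ip\<^sub>p ip\<^sub>m D\<^sub>0 (\<lambda>u. - A\<^sub>0 u) D (\<lambda>v. - A v) G\<^sub>p G\<^sub>m"
proof (intro boundary_maps.intro boundary_maps_axioms.intro real_hilbert_form_axioms
    M.real_inner_form_axioms P.real_inner_form_axioms)
  show "v \<in> D \<and> - A v = g \<longleftrightarrow> (\<forall>u\<in>D\<^sub>0. ip (- A\<^sub>0 u) v + ip u g = 0)" for v g
  proof -
    have "- A v = g \<longleftrightarrow> A v = - g" by auto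
    moreover have "ip (- A\<^sub>0 u) v + ip u g = 0 \<longleftrightarrow> ip (A\<^sub>0 u) v + ip u (- g) = 0" for u
      by (auto simp: ip_simps)
    ultimately show ?thesis using A_iff[of v "- g"] by simp
  qed
  show "ip (- A u) v + ip u (- A v) = ip\<^sub>m (G\<^sub>m u) (G\<^sub>m v) - ip\<^sub>p (G\<^sub>p u) (G\<^sub>p v)"
    if "u \<in> D" "v \<in> D" for u v
    using green[OF that] by (simp add: ip_simps)
qed (use D\<^sub>0_dense D\<^sub>0_D G\<^sub>m_add G\<^sub>p_add G\<^sub>m_scaleR G\<^sub>p_scaleR G\<^sub>m_ker G\<^sub>p_ker in auto)

text \<open>The left side of Green's identity vanishes when one argument lies in
  \<open>D\<^sub>0\<close>; pairing with an element of boundary values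
  \<open>(0, G\<^sub>p u)\<close> isolates the norm of \<open>G\<^sub>p u\<close>.\<close>

lemma G\<^sub>p_D\<^sub>0: "G\<^sub>p u = 0" if "u \<in> D\<^sub>0"
proof -
  obtain v where v: "v \<in> D" "G\<^sub>m v = 0" "G\<^sub>p v = G\<^sub>p u" using G\<^sub>p_ker by blast
  have "ip\<^sub>p (G\<^sub>p u) (G\<^sub>p u) = 0"
    using green[of u v] A_D[OF v(1) that] D\<^sub>0_D[OF that] v by simp
  then show ?thesis by (simp add: P.ip_self)
qed

lemma closed_graph:
  assumes "\<And>n. f n \<in> D" "f \<longlonglongrightarrow> x" "(\<lambda>n. A (f n)) \<longlonglongrightarrow> y"
  shows "x \<in> D \<and> A x = y"
proof (rule D_A)
  fix u assume "u \<in> D\<^sub>0"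
  have "(\<lambda>n. ip (A\<^sub>0 u) (f n) + ip u (A (f n))) \<longlonglongrightarrow> ip (A\<^sub>0 u) x + ip u y"
    by (intro tendsto_intros bilin.tendsto assms)
  then show "ip (A\<^sub>0 u) x + ip u y = 0"
    by (simp add: A_D[OF assms(1) \<open>u \<in> D\<^sub>0\<close>] LIMSEQ_const_iff)
qed

text \<open>
  The restriction of \<open>A\<close> to the kernel of \<open>G\<^sub>p\<close> is m-dissipative: it is closed and dissipative, and
  its adjoint is the restriction of \<open>-A\<close> to the kernel of \<open>G\<^sub>m\<close>, which is dissipative as well.
\<close>

lemma surj_ker_G\<^sub>p: "(\<lambda>x. x - A x) ` {x \<in> D. G\<^sub>p x = 0} = UNIV"
proof (rule surj_of_bounded_below)
  show "subspace {x \<in> D. G\<^sub>p x = 0}"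
    using subspace_D G\<^sub>p_add G\<^sub>p_scaleR[of 0 0] G\<^sub>p_scaleR by (simp add: subspace_def)
  show "x + y - A (x + y) = x - A x + (y - A y)"
    if "x \<in> {x \<in> D. G\<^sub>p x = 0}" "y \<in> {x \<in> D. G\<^sub>p x = 0}" for x y
    using add_D[of x y] that by simp
  show "r *\<^sub>R x - A (r *\<^sub>R x) = r *\<^sub>R (x - A x)" if "x \<in> {x \<in> D. G\<^sub>p x = 0}" for r x
    using scaleR_D[of x r] that by (simp add: scaleR_diff_right)
  show "norm x \<le> norm (x - A x)" if "x \<in> {x \<in> D. G\<^sub>p x = 0}" for x
  proof -
    have "2 * ip (A x) x = - (norm (G\<^sub>m x))\<^sup>2"
      using green[of x x] that ip_commute[of x "A x"] by (simp add: M.ip_self)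
    then have "ip (A x) x \<le> 0"
      using zero_le_power2[of "norm (G\<^sub>m x)"] by linarith
    then have "(norm x)\<^sup>2 \<le> (norm (x - A x))\<^sup>2"
      using ip_commute[of x "A x"] zero_le_power2[of "norm (A x)"]
      unfolding norm_diff_sq by linarith
    then show ?thesis by (simp add: power2_le_iff_abs_le)
  qed
  show "x \<in> {x \<in> D. G\<^sub>p x = 0} \<and> x - A x = y"
    if f: "\<And>n. f n \<in> {x \<in> D. G\<^sub>p x = 0}" "f \<longlonglongrightarrow> x" "(\<lambda>n. f n - A (f n)) \<longlonglongrightarrow> y" for f x y
  proof -
    have fD: "f n \<in> D" "G\<^sub>p (f n) = 0" for n using f(1) by simp_all
    have Af: "(\<lambda>n. A (f n)) \<longlonglongrightarrow> x - y"
      using tendsto_diff[OF f(2,3)] by simp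
    from closed_graph[OF fD(1) f(2) this] have x: "x \<in> D" "A x = x - y" by simp_all
    \<comment> \<open>In place of continuity of \<open>G\<^sub>p\<close>, Green's identity with this
      \<open>v\<close> is passed to the limit, where it reads
      \<open>(norm (G\<^sub>p x))\<^sup>2 = 0\<close>.\<close>
    obtain v where v: "v \<in> D" "G\<^sub>m v = 0" "G\<^sub>p v = G\<^sub>p x" using G\<^sub>p_ker by blast
    have "(\<lambda>n. ip (A (f n)) v + ip (f n) (A v)) \<longlonglongrightarrow> ip (x - y) v + ip x (A v)"
      by (intro tendsto_intros bilin.tendsto f Af)
    moreover have "ip (A (f n)) v + ip (f n) (A v) = 0" for n
      using green[OF fD(1) v(1)] v fD(2) by simp
    ultimately have "ip (A x) v + ip x (A v) = 0"
      by (simp add: LIMSEQ_const_iff x(2))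
    then have "G\<^sub>p x = 0"
      using green[OF x(1) v(1)] v by (simp add: P.ip_self)
    then show ?thesis using x by simp
  qed
  show "y = 0" if y: "\<And>x. x \<in> {x \<in> D. G\<^sub>p x = 0} \<Longrightarrow> ip (x - A x) y = 0" for y
  proof -
    have "y \<in> D \<and> A y = - y"
    proof (rule D_A)
      show "ip (A\<^sub>0 u) y + ip u (- y) = 0" if "u \<in> D\<^sub>0" for u
        using y[of u] G\<^sub>p_D\<^sub>0[OF that] D\<^sub>0_D[OF that] by (simp add: ip_simps)
    qed
    then have yD: "y \<in> D" "A y = - y" by simp_all
    \<comment> \<open>Testing on \<open>D\<^sub>0\<close> only gave \<open>A y = - y\<close>. The
      boundary values \<open>(G\<^sub>m y, 0)\<close> of this \<open>x\<close> now force
      \<open>G\<^sub>m y = 0\<close>, after which Green's identity for \<open>y\<close> has a single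
      sign.\<close>
    obtain x where x: "x \<in> D" "G\<^sub>p x = 0" "G\<^sub>m x = G\<^sub>m y" using G\<^sub>m_ker by blast
    have "ip (A x) y + ip x (A y) = 0"
      using y[of x] x yD by (simp add: ip_simps)
    then have "G\<^sub>m y = 0"
      using green[OF x(1) yD(1)] x by (simp add: M.ip_self)
    then have "(norm (G\<^sub>p y))\<^sup>2 + 2 * (norm y)\<^sup>2 = 0"
      using green[OF yD(1) yD(1)] yD by (simp add: ip_simps ip_self P.ip_self)
    then have "(norm y)\<^sup>2 \<le> 0" using zero_le_power2[of "norm (G\<^sub>p y)"] by linarith
    then show ?thesis by simp
  qed
qed

text \<open>Any lift of \<open>b\<close> is corrected by an element of the kernel of
  \<open>G\<^sub>p\<close> with the same image under \<open>1 - A\<close>; the boundary value is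
  untouched.\<close>

lemma eigenvector_lift: "\<exists>z\<in>D. A z = z \<and> G\<^sub>p z = b"
proof -
  obtain w where w: "w \<in> D" "G\<^sub>p w = b" using boundary_lift by blast
  have "w - A w \<in> (\<lambda>x. x - A x) ` {x \<in> D. G\<^sub>p x = 0}" by (simp only: surj_ker_G\<^sub>p UNIV_I)
  then obtain x where x: "x \<in> D" "G\<^sub>p x = 0" "w - A w = x - A x" by blast
  have "A (w - x) = w - x"
    using x(3) unfolding diff_D(2)[OF w(1) x(1)] by (simp add: algebra_simps)
  then show ?thesis
    using diff_D[OF w(1) x(1)] w(2) x(2) by (intro bexI[of _ "w - x"]) simp_all
qed

text \<open>
  A Cauchy sequence of boundary values lifts to a convergent sequence of eigenvectors. Its limit has
  the right boundary value because Green's identity makes \<open>G\<^sub>p\<close> weakly continuous.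
\<close>

lemma complete_H\<^sub>p: "complete (UNIV :: 'p set)"
  unfolding complete_def
proof (intro allI impI, elim conjE)
  fix b :: "nat \<Rightarrow> 'p" assume "Cauchy b"
  have "\<exists>z. z \<in> D \<and> A z = z \<and> G\<^sub>p z = b n" for n using eigenvector_lift by blast
  then obtain z where z: "\<And>n. z n \<in> D" "\<And>n. A (z n) = z n" "\<And>n. G\<^sub>p (z n) = b n" by metis
  have "norm (z m - z n) \<le> norm (b m - b n)" for m n
  proof -
    have d: "z m - z n \<in> D" "A (z m - z n) = z m - z n" "G\<^sub>p (z m - z n) = b m - b n"
      using diff_D[OF z(1)[of m] z(1)[of n]] z(2,3) by simp_all
    have "2 * (norm (z m - z n))\<^sup>2 = (norm (b m - b n))\<^sup>2 - (norm (G\<^sub>m (z m - z n)))\<^sup>2"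
      using green[OF d(1) d(1)] unfolding d(2,3) by (simp add: ip_self P.ip_self M.ip_self)
    then have "(norm (z m - z n))\<^sup>2 \<le> (norm (b m - b n))\<^sup>2"
      using zero_le_power2[of "norm (z m - z n)"] zero_le_power2[of "norm (G\<^sub>m (z m - z n))"] by linarith
    then show ?thesis by (simp add: power2_le_iff_abs_le)
  qed
  then have "Cauchy z"
    using \<open>Cauchy b\<close> unfolding Cauchy_iff by (meson le_less_trans)
  then obtain l where l: "z \<longlonglongrightarrow> l" using Cauchy_convergent convergentD by blast
  have "l \<in> D \<and> A l = l"
    by (rule closed_graph[OF z(1) l]) (simp only: z(2) l)
  then have lD: "l \<in> D" "A l = l" by simp_all
  have "b \<longlonglongrightarrow> G\<^sub>p l"
  proof (rule P.tendsto_of_Cauchy_weak[OF \<open>Cauchy b\<close>])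
    fix c
    obtain v where v: "v \<in> D" "G\<^sub>m v = 0" "G\<^sub>p v = c" using G\<^sub>p_ker by blast
    have "(\<lambda>n. ip (z n) v + ip (z n) (A v)) \<longlonglongrightarrow> ip l v + ip l (A v)"
      by (intro tendsto_intros bilin.tendsto l)
    moreover have "ip (z n) v + ip (z n) (A v) = ip\<^sub>p (b n) c" for n
      using green[OF z(1)[of n] v(1)] v z by simp
    moreover have "ip l v + ip l (A v) = ip\<^sub>p (G\<^sub>p l) c"
      using green[OF lD(1) v(1)] v lD by simp
    ultimately show "(\<lambda>n. ip\<^sub>p (b n) c) \<longlonglongrightarrow> ip\<^sub>p (G\<^sub>p l) c" by simp
  qed
  then show "\<exists>l\<in>UNIV. b \<longlonglongrightarrow> l" by blast
qed

lemma complete_H\<^sub>m: "complete (UNIV :: 'm set)"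
  by (rule boundary_maps.complete_H\<^sub>p[OF swap])

text \<open>Neutrality transports Cauchy sequences from one boundary space to the other. Both limits
  exist by completeness, their joint lift annihilates \<open>S\<close> in the limit, and maximality
  puts it in \<open>S\<close>; hence the range is complete.\<close>

lemma G\<^sub>m_surj_of_hypermaximal:
  assumes S: "subspace S" "S \<subseteq> D"
    and neutral: "\<And>u v. u \<in> S \<Longrightarrow> v \<in> S \<Longrightarrow> ip\<^sub>p (G\<^sub>p u) (G\<^sub>p v) = ip\<^sub>m (G\<^sub>m u) (G\<^sub>m v)"
    and maximal: "\<And>v. v \<in> D \<Longrightarrow> (\<And>u. u \<in> S \<Longrightarrow> ip\<^sub>p (G\<^sub>p u) (G\<^sub>p v) = ip\<^sub>m (G\<^sub>m u) (G\<^sub>m v)) \<Longrightarrow> v \<in> S"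
  shows "G\<^sub>m ` S = UNIV"
proof (rule M.complete_subspace_eq_UNIV)
  show "subspace (G\<^sub>m ` S)"
    unfolding subspace_def
  proof (intro conjI ballI allI)
    show "0 \<in> G\<^sub>m ` S"
      using G\<^sub>m_scaleR[of 0 0] subspace_0[OF S(1)] S(2) by (intro image_eqI[of _ _ 0]) auto
  next
    fix x y assume "x \<in> G\<^sub>m ` S" "y \<in> G\<^sub>m ` S"
    then obtain u v where "u \<in> S" "v \<in> S" "x = G\<^sub>m u" "y = G\<^sub>m v" by blast
    then show "x + y \<in> G\<^sub>m ` S"
      using G\<^sub>m_add[of u v] subsetD[OF S(2)] subspace_add[OF S(1), of u v] by (intro image_eqI[of _ _ "u + v"]) auto
  next
    fix r x assume "x \<in> G\<^sub>m ` S"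
    then obtain u where "u \<in> S" "x = G\<^sub>m u" by blast
    then show "r *\<^sub>R x \<in> G\<^sub>m ` S"
      using G\<^sub>m_scaleR[of u r] S(2) subspace_scale[OF S(1), of u r]
      by (intro image_eqI[of _ _ "r *\<^sub>R u"]) auto
  qed
  show "complete (G\<^sub>m ` S)"
    unfolding complete_def
  proof (intro allI impI, elim conjE)
    fix g :: "nat \<Rightarrow> 'm" assume g: "\<forall>n. g n \<in> G\<^sub>m ` S" and "Cauchy g"
    have "\<forall>n. \<exists>u. u \<in> S \<and> g n = G\<^sub>m u" using g by blast
    then obtain u where u: "\<And>n. u n \<in> S" "\<And>n. G\<^sub>m (u n) = g n"
      using choice[of "\<lambda>n u. u \<in> S \<and> g n = G\<^sub>m u"] by metis
    have uD: "u n \<in> D" for n using u(1) S(2) by blast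
    have "norm (G\<^sub>p (u m) - G\<^sub>p (u n)) = norm (g m - g n)" for m n
    proof -
      have "u m - u n \<in> S" using u(1) S(1) by (intro subspace_diff)
      from neutral[OF this this] have "(norm (G\<^sub>p (u m) - G\<^sub>p (u n)))\<^sup>2 = (norm (g m - g n))\<^sup>2"
        unfolding diff_D(3,4)[OF uD uD] u(2) P.ip_self M.ip_self .
      then show ?thesis by simp
    qed
    then have "Cauchy (\<lambda>n. G\<^sub>p (u n))"
      using \<open>Cauchy g\<close> unfolding Cauchy_iff by simp
    then obtain b where b: "(\<lambda>n. G\<^sub>p (u n)) \<longlonglongrightarrow> b"
      using complete_H\<^sub>p unfolding complete_def by blast
    obtain a where a: "g \<longlonglongrightarrow> a"
      using complete_H\<^sub>m \<open>Cauchy g\<close> unfolding complete_def by blast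
    obtain w where w: "w \<in> D" "G\<^sub>m w = a" "G\<^sub>p w = b" using boundary_lift by blast
    have "w \<in> S"
    proof (rule maximal[OF w(1)])
      fix v assume "v \<in> S"
      have "ip\<^sub>p (G\<^sub>p v) (G\<^sub>p (u n)) = ip\<^sub>m (G\<^sub>m v) (g n)" for n
        using neutral[OF \<open>v \<in> S\<close> u(1)] u(2) by simp
      then have "(\<lambda>n. ip\<^sub>m (G\<^sub>m v) (g n)) \<longlonglongrightarrow> ip\<^sub>p (G\<^sub>p v) b"
        using P.bilin.tendsto[OF tendsto_const b, of "G\<^sub>p v"] by simp
      moreover have "(\<lambda>n. ip\<^sub>m (G\<^sub>m v) (g n)) \<longlonglongrightarrow> ip\<^sub>m (G\<^sub>m v) a"
        by (intro M.bilin.tendsto tendsto_const a)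
      ultimately show "ip\<^sub>p (G\<^sub>p v) (G\<^sub>p w) = ip\<^sub>m (G\<^sub>m v) (G\<^sub>m w)"
        unfolding w by (rule LIMSEQ_unique)
    qed
    then show "\<exists>l\<in>G\<^sub>m ` S. g \<longlonglongrightarrow> l" using a w(2) by blast
  qed
  show "a = 0" if a: "\<And>m. m \<in> G\<^sub>m ` S \<Longrightarrow> ip\<^sub>m a m = 0" for a
  proof -
    \<comment> \<open>The boundary pair \<open>(a, 0)\<close> annihilates \<open>S\<close>, hence
      belongs to \<open>S\<close>, and neutrality there gives \<open>norm a = 0\<close>.\<close>
    obtain w where w: "w \<in> D" "G\<^sub>m w = a" "G\<^sub>p w = 0" using boundary_lift by blast
    have "w \<in> S"
      using a M.ip_commute w by (intro maximal[OF w(1)]) auto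
    from neutral[OF this this] show ?thesis by (simp add: w M.ip_self)
  qed
qed

lemma boundary_surj_of_hypermaximal:
  assumes S: "subspace S" "S \<subseteq> D"
    and neutral: "\<And>u v. u \<in> S \<Longrightarrow> v \<in> S \<Longrightarrow> ip\<^sub>p (G\<^sub>p u) (G\<^sub>p v) = ip\<^sub>m (G\<^sub>m u) (G\<^sub>m v)"
    and maximal: "\<And>v. v \<in> D \<Longrightarrow> (\<And>u. u \<in> S \<Longrightarrow> ip\<^sub>p (G\<^sub>p u) (G\<^sub>p v) = ip\<^sub>m (G\<^sub>m u) (G\<^sub>m v)) \<Longrightarrow> v \<in> S"
  shows "G\<^sub>m ` S = UNIV" "G\<^sub>p ` S = UNIV"
proof -
  show "G\<^sub>m ` S = UNIV" using assms by (rule G\<^sub>m_surj_of_hypermaximal)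
  show "G\<^sub>p ` S = UNIV"
  proof (rule boundary_maps.G\<^sub>m_surj_of_hypermaximal[OF swap S])
    show "ip\<^sub>m (G\<^sub>m u) (G\<^sub>m v) = ip\<^sub>p (G\<^sub>p u) (G\<^sub>p v)" if "u \<in> S" "v \<in> S" for u v
      using neutral[OF that] by simp
    show "v \<in> S" if "v \<in> D" "\<And>u. u \<in> S \<Longrightarrow> ip\<^sub>m (G\<^sub>m u) (G\<^sub>m v) = ip\<^sub>p (G\<^sub>p u) (G\<^sub>p v)" for v
      using that(2) by (intro maximal[OF that(1)]) simp
  qed
qed

lemma skew_adjoint_of_isometry:
  assumes "linear \<Phi>" "surj \<Phi>" "\<And>x. norm (\<Phi> x) = norm x"
  shows "skew_adjoint ip {w \<in> D. \<Phi> (G\<^sub>m w) = G\<^sub>p w} A"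
proof (intro skew_adjoint.intro skew_adjoint_axioms.intro real_hilbert_form_axioms)
  have ip_\<Phi>: "ip\<^sub>p (\<Phi> x) (\<Phi> y) = ip\<^sub>m x y" for x y
    by (simp add: P.ip_polarization M.ip_polarization assms(3)
        linear_add[OF assms(1), symmetric] linear_diff[OF assms(1), symmetric])
  have D\<^sub>0: "D\<^sub>0 \<subseteq> {w \<in> D. \<Phi> (G\<^sub>m w) = G\<^sub>p w}"
    using D\<^sub>0_D G\<^sub>p_D\<^sub>0 boundary_maps.G\<^sub>p_D\<^sub>0[OF swap] linear_0[OF assms(1)] by auto
  then show "closure {w \<in> D. \<Phi> (G\<^sub>m w) = G\<^sub>p w} = UNIV"
    using closure_mono D\<^sub>0_dense by blast
  show "ip (A x) y + ip x (A y) = 0"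
    if "x \<in> {w \<in> D. \<Phi> (G\<^sub>m w) = G\<^sub>p w}" "y \<in> {w \<in> D. \<Phi> (G\<^sub>m w) = G\<^sub>p w}" for x y
  proof -
    have x: "x \<in> D" "G\<^sub>p x = \<Phi> (G\<^sub>m x)" and y: "y \<in> D" "G\<^sub>p y = \<Phi> (G\<^sub>m y)"
      using that by simp_all
    show ?thesis unfolding green[OF x(1) y(1)] x(2) y(2) ip_\<Phi> by simp
  qed
  show "v \<in> {w \<in> D. \<Phi> (G\<^sub>m w) = G\<^sub>p w} \<and> A v = g"
    if v: "\<And>u. u \<in> {w \<in> D. \<Phi> (G\<^sub>m w) = G\<^sub>p w} \<Longrightarrow> ip (A u) v + ip u g = 0" for v g
  proof -
    have "v \<in> D \<and> A v = g"
    proof (rule D_A)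
      show "ip (A\<^sub>0 u) v + ip u g = 0" if "u \<in> D\<^sub>0" for u
        using v[of u] D\<^sub>0 that D\<^sub>0_D[OF that] by auto
    qed
    then have vD: "v \<in> D" "A v = g" by simp_all
    \<comment> \<open>The defect in the boundary condition is itself of the form
      \<open>\<Phi> a\<close>; the element with boundary values \<open>(a, \<Phi> a)\<close> is
      admissible and shows that the defect is orthogonal to itself.\<close>
    obtain a where a: "\<Phi> a = \<Phi> (G\<^sub>m v) - G\<^sub>p v" using assms(2) by (metis surjD)
    obtain u where u: "u \<in> D" "G\<^sub>m u = a" "G\<^sub>p u = \<Phi> a" using boundary_lift by blast
    have "ip\<^sub>p (\<Phi> a) (G\<^sub>p v) = ip\<^sub>m a (G\<^sub>m v)"
      using v[of u] green[OF u(1) vD(1)] u vD(2) by simp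
    then have "ip\<^sub>p (\<Phi> a) (\<Phi> (G\<^sub>m v) - G\<^sub>p v) = 0"
      by (simp add: P.ip_diff_right ip_\<Phi>)
    then have "\<Phi> (G\<^sub>m v) = G\<^sub>p v"
      unfolding a by (simp add: P.ip_self)
    then show ?thesis using vD by simp
  qed
qed

end

section \<open>Real parts of inner products\<close>

lemma to_complex_zero [simp]: "to_complex 0 = 0"
  using to_complex_scaleR[of 0 0] by simp

lemma to_complex_minus: "to_complex (- x) = - to_complex x"
  using to_complex_scaleR[of "-1" x] by simp

lemma to_complex_diff: "to_complex (x - y) = to_complex x - to_complex y"
  using to_complex_add[of x "- y"] by (simp add: to_complex_minus)

lemma to_complex_of_real: "to_complex (of_real r :: 'k::real_or_complex) = of_real r"
  using to_complex_scaleR[of r "1 :: 'k"] by (simp add: of_real_def to_complex_one)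

lemma to_complex_of_real_power: "to_complex ((of_real r :: 'k::real_or_complex)\<^sup>2) = (of_real r)\<^sup>2"
  by (simp add: power2_eq_square to_complex_mult to_complex_of_real)

lemma to_complex_eq_iff [simp]: "to_complex x = to_complex y \<longleftrightarrow> x = y"
  using inj_to_complex by (auto dest: injD)

lemma to_complex_eq_0_iff [simp]: "to_complex (x :: 'k::real_or_complex) = 0 \<longleftrightarrow> x = 0"
  using to_complex_eq_iff[of x 0] by (simp only: to_complex_zero)

definition re_form :: "('v \<Rightarrow> 'v \<Rightarrow> 'k::real_or_complex) \<Rightarrow> 'v \<Rightarrow> 'v \<Rightarrow> real" where
  "re_form ip x y = Re (to_complex (ip x y))"

context pre_hilbert_space
begin

lemma real_inner_form_re_form: "real_inner_form (re_form inner)"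
proof
  show "re_form inner (x + y) z = re_form inner x z + re_form inner y z" for x y z
    by (simp add: re_form_def inner_add_left to_complex_add)
  show "re_form inner (r *\<^sub>R x) y = r * re_form inner x y" for r x y
    by (simp add: re_form_def inner_scale_left to_complex_mult to_complex_of_real flip: scale_of_real)
  show "re_form inner x y = re_form inner y x" for x y
    by (simp add: re_form_def inner_commute[of x y] to_complex_scalar_cnj)
  show "re_form inner x x = (norm x)\<^sup>2" for x
    by (simp add: re_form_def norm_eq to_complex_of_real_power)
qed

text \<open>Taking for \<open>c\<close> the conjugate of the difference of the two sides turns that
  difference into its squared modulus, which its real part detects.\<close>

lemma eq_of_re_form_eq:
  assumes "\<And>c. re_form inner (scale c u) v = re_form inner (scale c u') v'"
  shows "inner u v = inner u' v'"
proof -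
  define z where "z = inner u v - inner u' v'"
  have "Re (to_complex (scalar_cnj z * z)) = 0"
    using assms[of "scalar_cnj z"]
    by (simp add: re_form_def inner_scale_left z_def right_diff_distrib to_complex_diff)
  then have "(cmod (to_complex z))\<^sup>2 = 0"
    by (simp add: to_complex_mult to_complex_scalar_cnj cmod_power2 power2_eq_square complex_eq_iff)
  then have "z = 0" by simp
  then show ?thesis by (simp add: z_def)
qed

lemma norm_scale: "norm (scale c x) = cmod (to_complex c) * norm x"
proof -
  have "of_real ((norm (scale c x))\<^sup>2) = to_complex (inner (scale c x) (scale c x))"
    by (simp add: norm_eq to_complex_of_real_power)
  also have "\<dots> = to_complex c * cnj (to_complex c * to_complex (inner x x))"
    using inner_commute[of x "scale c x"]
    by (simp add: inner_scale_left to_complex_mult to_complex_scalar_cnj)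
  also have "\<dots> = (to_complex c * cnj (to_complex c)) * of_real ((norm x)\<^sup>2)"
    by (simp add: norm_eq to_complex_of_real_power)
  also have "\<dots> = of_real ((cmod (to_complex c) * norm x)\<^sup>2)"
    unfolding complex_norm_square[symmetric] by (simp add: power_mult_distrib)
  finally show ?thesis
    by (simp only: of_real_eq_iff) (simp add: power2_eq_iff_nonneg)
qed

lemma bounded_linear_scale: "bounded_linear (scale c)"
proof (rule bounded_linear_intro)
  show "scale c (r *\<^sub>R x) = r *\<^sub>R scale c x" for r x
    by (simp add: scale_left_commute flip: scale_of_real)
  show "norm (scale c x) \<le> norm x * cmod (to_complex c)" for x
    by (simp add: norm_scale mult.commute)
qed (rule scale_right_distrib)

end

lemma (in hilbert_space) real_hilbert_form_re_form: "real_hilbert_form (re_form inner)"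
  by (intro real_hilbert_form.intro real_inner_form_re_form)

lemma linear_real_of_scale:
  assumes "pre_hilbert_space s1 ip1" "pre_hilbert_space s2 ip2" "Vector_Spaces.linear s1 s2 f"
  shows "linear f"
proof -
  interpret pre1: pre_hilbert_space s1 ip1 by fact
  interpret pre2: pre_hilbert_space s2 ip2 by fact
  interpret f: Vector_Spaces.linear s1 s2 f by fact
  show ?thesis
    by (rule linearI) (simp_all add: f.add f.scale flip: pre1.scale_of_real pre2.scale_of_real)
qed

lemma linear_map_on_real:
  assumes "pre_hilbert_space s1 ip1" "pre_hilbert_space s2 ip2" "linear_map_on s1 s2 S f"
  shows "subspace S" and "x \<in> S \<Longrightarrow> y \<in> S \<Longrightarrow> f (x + y) = f x + f y"
    and "x \<in> S \<Longrightarrow> f (r *\<^sub>R x) = r *\<^sub>R f x"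
proof -
  interpret pre1: pre_hilbert_space s1 ip1 by fact
  interpret pre2: pre_hilbert_space s2 ip2 by fact
  have S: "module.subspace s1 S" using assms(3) by (simp add: linear_map_on_def)
  show "subspace S"
    using pre1.subspace_0[OF S] pre1.subspace_add[OF S] pre1.subspace_scale[OF S]
    by (auto simp: subspace_def simp flip: pre1.scale_of_real)
  show "x \<in> S \<Longrightarrow> y \<in> S \<Longrightarrow> f (x + y) = f x + f y"
    and "x \<in> S \<Longrightarrow> f (r *\<^sub>R x) = r *\<^sub>R f x"
    using assms(3) by (auto simp: linear_map_on_def simp flip: pre1.scale_of_real pre2.scale_of_real)
qed

text \<open>The domain of \<open>T\<close> is invariant under scalars, so real parts suffice to test
  the adjoint identity; density makes its solution unique, so the description in
  \<open>adjoint_op\<close> denotes it.\<close>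

lemma uminus_adjoint_eq_Some_iff:
  fixes scale :: "'k::real_or_complex \<Rightarrow> 'v::banach \<Rightarrow> 'v" and T :: "'v \<rightharpoonup> 'v"
  assumes "hilbert_space scale ip" "linear_operator scale T" "densely_defined T"
  shows "uminus_op (adjoint_op ip T) v = Some g \<longleftrightarrow>
    (\<forall>u\<in>dom T. re_form ip (the (T u)) v + re_form ip u g = 0)"
proof -
  interpret hilbert_space scale ip by fact
  interpret R: real_hilbert_form "re_form ip" by (rule real_hilbert_form_re_form)
  have T: "\<And>c u. u \<in> dom T \<Longrightarrow> scale c u \<in> dom T"
    "\<And>c u. u \<in> dom T \<Longrightarrow> the (T (scale c u)) = scale c (the (T u))"
    using assms(2) subspace_scale by (auto simp: linear_operator_def linear_map_on_def)
  have iff: "(\<forall>u\<in>dom T. ip (the (T u)) v = ip u f) \<longleftrightarrow>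
      (\<forall>u\<in>dom T. re_form ip (the (T u)) v = re_form ip u f)" for f
  proof (intro iffI ballI)
    show "re_form ip (the (T u)) v = re_form ip u f"
      if "\<forall>u\<in>dom T. ip (the (T u)) v = ip u f" "u \<in> dom T" for u
      using that by (simp add: re_form_def)
    show "ip (the (T u)) v = ip u f"
      if "\<forall>u\<in>dom T. re_form ip (the (T u)) v = re_form ip u f" "u \<in> dom T" for u
      using that T by (intro eq_of_re_form_eq) metis
  qed
  have unique: "f = f'"
    if "\<forall>u\<in>dom T. ip (the (T u)) v = ip u f" "\<forall>u\<in>dom T. ip (the (T u)) v = ip u f'" for f f'
  proof -
    have "re_form ip u f = re_form ip u f'" if "u \<in> dom T" for u
      using \<open>\<forall>u\<in>dom T. _ = ip u f\<close> \<open>\<forall>u\<in>dom T. _ = ip u f'\<close> that by (simp add: re_form_def)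
    then have "f - f' = 0"
      using assms(3)
      by (intro R.eq_zero_of_ip_dense[of "dom T"]) (auto simp: densely_defined_def R.ip_diff_right)
    then show ?thesis by simp
  qed
  have adj: "adjoint_op ip T v = Some f \<longleftrightarrow> (\<forall>u\<in>dom T. ip (the (T u)) v = ip u f)" for f
  proof
    assume "adjoint_op ip T v = Some f"
    then have ex: "\<exists>f. \<forall>u\<in>dom T. ip (the (T u)) v = ip u f"
      and f: "f = (THE f. \<forall>u\<in>dom T. ip (the (T u)) v = ip u f)"
      by (auto simp: adjoint_op_def split: if_splits)
    have "\<exists>!f. \<forall>u\<in>dom T. ip (the (T u)) v = ip u f" using ex unique by blast
    from theI'[OF this] show "\<forall>u\<in>dom T. ip (the (T u)) v = ip u f" unfolding f .
  next
    assume f: "\<forall>u\<in>dom T. ip (the (T u)) v = ip u f"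
    then have "(THE f. \<forall>u\<in>dom T. ip (the (T u)) v = ip u f) = f"
      using unique by (intro the_equality) blast+
    then show "adjoint_op ip T v = Some f" using f by (auto simp: adjoint_op_def)
  qed
  have "uminus_op (adjoint_op ip T) v = Some g \<longleftrightarrow> adjoint_op ip T v = Some (- g)"
    by (auto simp: uminus_op_def)
  also have "\<dots> \<longleftrightarrow> (\<forall>u\<in>dom T. re_form ip (the (T u)) v + re_form ip u g = 0)"
    unfolding adj iff R.ip_minus_right by (auto simp: eq_neg_iff_add_eq_0)
  finally show ?thesis .
qed

lemma boundary_maps_of_quadruple:
  fixes scale :: "'k::real_or_complex \<Rightarrow> 'v::banach \<Rightarrow> 'v" and A\<^sub>0 A :: "'v \<rightharpoonup> 'v"
  assumes "hilbert_space scale ip" "linear_operator scale A\<^sub>0" "densely_defined A\<^sub>0"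
    and skew: "skew_symmetric ip A\<^sub>0" and A: "A = uminus_op (adjoint_op ip A\<^sub>0)"
    and quad: "boundary_quadruple scale ip A\<^sub>0 scale\<^sub>m ip\<^sub>m scale\<^sub>p ip\<^sub>p G\<^sub>m G\<^sub>p"
  shows "boundary_maps (re_form ip) (re_form ip\<^sub>m) (re_form ip\<^sub>p) (dom A\<^sub>0) (\<lambda>u. the (A\<^sub>0 u))
    (dom A) (\<lambda>u. the (A u)) G\<^sub>m G\<^sub>p"
proof -
  interpret hilbert_space scale ip by fact
  have pre: "pre_hilbert_space scale\<^sub>m ip\<^sub>m" "pre_hilbert_space scale\<^sub>p ip\<^sub>p"
    and Gm: "linear_map_on scale scale\<^sub>m (dom A) G\<^sub>m" "G\<^sub>m ` dom A = UNIV"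
    and Gp: "linear_map_on scale scale\<^sub>p (dom A) G\<^sub>p" "G\<^sub>p ` dom A = UNIV"
    and green: "\<And>u v. u \<in> dom A \<Longrightarrow> v \<in> dom A \<Longrightarrow>
      ip (the (A u)) v + ip u (the (A v)) = ip\<^sub>p (G\<^sub>p u) (G\<^sub>p v) - ip\<^sub>m (G\<^sub>m u) (G\<^sub>m v)"
    and ker: "{x + y | x y. x \<in> dom A \<and> G\<^sub>m x = 0 \<and> y \<in> dom A \<and> G\<^sub>p y = 0} = dom A"
    using quad unfolding boundary_quadruple_def Let_def A[symmetric] by blast+
  have V: "pre_hilbert_space scale ip" by unfold_locales
  note Gm_real = linear_map_on_real[OF V pre(1) Gm(1)] and Gp_real = linear_map_on_real[OF V pre(2) Gp(1)]
  have A_iff: "A v = Some g \<longleftrightarrow> (\<forall>u\<in>dom A\<^sub>0. re_form ip (the (A\<^sub>0 u)) v + re_form ip u g = 0)" for v g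
    unfolding A by (rule uminus_adjoint_eq_Some_iff[OF assms(1-3)])
  have split: "\<exists>x y. u = x + y \<and> x \<in> dom A \<and> G\<^sub>m x = 0 \<and> y \<in> dom A \<and> G\<^sub>p y = 0" if "u \<in> dom A" for u
  proof -
    have "u \<in> {x + y | x y. x \<in> dom A \<and> G\<^sub>m x = 0 \<and> y \<in> dom A \<and> G\<^sub>p y = 0}"
      unfolding ker by (rule that)
    then show ?thesis by blast
  qed
  show ?thesis
  proof (intro boundary_maps.intro boundary_maps_axioms.intro real_hilbert_form_re_form
      pre[THEN pre_hilbert_space.real_inner_form_re_form])
    show "closure (dom A\<^sub>0) = UNIV" using assms(3) by (simp add: densely_defined_def)
    show "v \<in> dom A \<and> the (A v) = g \<longleftrightarrow>
        (\<forall>u\<in>dom A\<^sub>0. re_form ip (the (A\<^sub>0 u)) v + re_form ip u g = 0)" for v g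
      unfolding A_iff[symmetric] by auto
    show "u \<in> dom A \<and> the (A u) = the (A\<^sub>0 u)" if "u \<in> dom A\<^sub>0" for u
    proof -
      have "A u = Some (the (A\<^sub>0 u))"
        unfolding A_iff re_form_def
        using skew that by (simp add: skew_symmetric_def flip: plus_complex.simps(1) to_complex_add)
      then show ?thesis by auto
    qed
    show "re_form ip (the (A u)) v + re_form ip u (the (A v))
        = re_form ip\<^sub>p (G\<^sub>p u) (G\<^sub>p v) - re_form ip\<^sub>m (G\<^sub>m u) (G\<^sub>m v)" if "u \<in> dom A" "v \<in> dom A" for u v
      using arg_cong[OF green[OF that], of "\<lambda>z. Re (to_complex z)"]
      by (simp add: re_form_def to_complex_add to_complex_diff)
    show "\<exists>w\<in>dom A. G\<^sub>p w = 0 \<and> G\<^sub>m w = a" for a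
    proof -
      \<comment> \<open>Split \<open>u\<close> along the two kernels: the part in the kernel of
        \<open>G\<^sub>m\<close> does not contribute to \<open>a\<close>, so the part in the kernel
        of \<open>G\<^sub>p\<close> is the required element.\<close>
      obtain u where "u \<in> dom A" "G\<^sub>m u = a" using Gm(2) by (metis UNIV_I imageE)
      then show ?thesis using split[of u] Gm_real(2) by fastforce
    qed
    show "\<exists>w\<in>dom A. G\<^sub>m w = 0 \<and> G\<^sub>p w = b" for b
    proof -
      obtain u where "u \<in> dom A" "G\<^sub>p u = b" using Gp(2) by (metis UNIV_I imageE)
      then show ?thesis using split[of u] Gp_real(2) by fastforce
    qed
  qed (fact Gm_real Gp_real)+
qed

section \<open>Boundary conditions generating unitary groups\<close>

lemma linear_scaleI:
  assumes "pre_hilbert_space s1 ip1" "pre_hilbert_space s2 ip2"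
    and "\<And>x y. f (x + y) = f x + f y" "\<And>c x. f (s1 c x) = s2 c (f x)"
  shows "Vector_Spaces.linear s1 s2 f"
proof -
  interpret pre1: pre_hilbert_space s1 ip1 by fact
  interpret pre2: pre_hilbert_space s2 ip2 by fact
  show ?thesis
    using assms(3,4) by unfold_locales
qed

lemma generates_of_skew_adjoint:
  fixes scale :: "'k::real_or_complex \<Rightarrow> 'v::banach \<Rightarrow> 'v" and A B :: "'v \<rightharpoonup> 'v"
  assumes "hilbert_space scale ip" "linear_operator scale B"
    and skew: "skew_adjoint (re_form ip) (dom B) (\<lambda>x. the (B x))"
  shows "generates_unitary_c0_group scale B"
proof -
  interpret hilbert_space scale ip by fact
  interpret S: skew_adjoint "re_form ip" "dom B" "\<lambda>x. the (B x)" by fact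
  have V: "pre_hilbert_space scale ip" by unfold_locales
  have lin: "Vector_Spaces.linear scale scale (S.U t)" for t
  proof (rule linear_scaleI[OF V V])
    show "S.U t (x + y) = S.U t x + S.U t y" for x y
      by (rule linear_add[OF S.linear_U])
    show "S.U t (scale c x) = scale c (S.U t x)" for c x
    proof (rule S.U_commute[OF bounded_linear_scale, symmetric])
      show "scale c x \<in> dom B \<and> the (B (scale c x)) = scale c (the (B x))" if "x \<in> dom B" for x
        using assms(2) that subspace_scale by (auto simp: linear_operator_def linear_map_on_def)
    qed
  qed
  have "isCont (\<lambda>t. S.U t x) s" for x s
  proof -
    have "((\<lambda>t. S.U t (S.U s x)) \<longlongrightarrow> S.U s x) (at 0)" by (rule S.U.U_continuous)
    then have "((\<lambda>h. S.U (s + h) x) \<longlongrightarrow> S.U s x) (at 0)"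
      by (simp add: S.U_add add.commute[of s])
    then show ?thesis by (simp add: isCont_iff)
  qed
  then have "c0_group scale S.U"
    unfolding c0_group_def
    using lin S.U.bounded_linear_U S.U_0 S.U_add by (auto intro!: continuous_at_imp_continuous_on)
  moreover have "surj (S.U t)" for t
    using S.U.U_minus by (metis surjI)
  then have "unitary_operator scale scale (S.U t)" for t
    unfolding unitary_operator_def using lin S.norm_U by blast
  moreover have "B = generator S.U"
    by (rule ext) (auto simp: S.generator_U)
  ultimately show ?thesis
    unfolding generates_unitary_c0_group_def by blast
qed

lemma unitary_group_of_c0_group:
  fixes scale :: "'k::real_or_complex \<Rightarrow> 'v::banach \<Rightarrow> 'v"
  assumes "hilbert_space scale ip" "c0_group scale U" "\<And>t. unitary_operator scale scale (U t)"
  shows "unitary_group (re_form ip) U"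
proof -
  interpret hilbert_space scale ip by fact
  have V: "pre_hilbert_space scale ip" by unfold_locales
  show ?thesis
  proof (intro unitary_group.intro unitary_group_axioms.intro real_hilbert_form_re_form)
    show "linear (U t)" for t
      using assms(2) by (intro linear_real_of_scale[OF V V]) (simp add: c0_group_def)
    show "norm (U t x) = norm x" for t x
      using assms(3) by (simp add: unitary_operator_def)
    show "U 0 x = x" "U (t + r) x = U t (U r x)" for t r x
      using assms(2) by (simp_all add: c0_group_def)
    show "((\<lambda>t. U t x) \<longlongrightarrow> x) (at 0)" for x
    proof -
      have "continuous_on UNIV (\<lambda>t. U t x)" "U 0 x = x"
        using assms(2) by (simp_all add: c0_group_def)
      then have "isCont (\<lambda>t. U t x) 0" by (simp add: continuous_on_eq_continuous_at)
      from isContD[OF this] show ?thesis by (simp only: \<open>U 0 x = x\<close>)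
    qed
  qed
qed

theorem theorem4p2:
  fixes scale :: "'k::real_or_complex \<Rightarrow> 'v::banach \<Rightarrow> 'v"
    and ip :: "'v \<Rightarrow> 'v \<Rightarrow> 'k"
    and scale\<^sub>m :: "'k \<Rightarrow> 'm::real_normed_vector \<Rightarrow> 'm"
    and ip\<^sub>m :: "'m \<Rightarrow> 'm \<Rightarrow> 'k"
    and scale\<^sub>p :: "'k \<Rightarrow> 'p::real_normed_vector \<Rightarrow> 'p"
    and ip\<^sub>p :: "'p \<Rightarrow> 'p \<Rightarrow> 'k"
    and A\<^sub>0 A B :: "'v \<rightharpoonup> 'v"
    and G\<^sub>m :: "'v \<Rightarrow> 'm" and G\<^sub>p :: "'v \<Rightarrow> 'p"
  assumes "hilbert_space scale ip"
    and "linear_operator scale A\<^sub>0" and "densely_defined A\<^sub>0" and "skew_symmetric ip A\<^sub>0"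
    and "A = uminus_op (adjoint_op ip A\<^sub>0)"
    and "boundary_quadruple scale ip A\<^sub>0 scale\<^sub>m ip\<^sub>m scale\<^sub>p ip\<^sub>p G\<^sub>m G\<^sub>p"
    and "linear_operator scale B" and "A\<^sub>0 \<subseteq>\<^sub>m B"
  shows "generates_unitary_c0_group scale B \<longleftrightarrow>
    (\<exists>\<Phi>. unitary_operator scale\<^sub>m scale\<^sub>p \<Phi> \<and> B = boundary_restriction A G\<^sub>m G\<^sub>p \<Phi>)"
proof -
  interpret V: hilbert_space scale ip by fact
  interpret Q: boundary_maps "re_form ip" "re_form ip\<^sub>m" "re_form ip\<^sub>p" "dom A\<^sub>0" "\<lambda>u. the (A\<^sub>0 u)"
    "dom A" "\<lambda>u. the (A u)" G\<^sub>m G\<^sub>p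
    by (rule boundary_maps_of_quadruple[OF assms(1-6)])
  have V: "pre_hilbert_space scale ip" by unfold_locales
  have pre: "pre_hilbert_space scale\<^sub>m ip\<^sub>m" "pre_hilbert_space scale\<^sub>p ip\<^sub>p"
    and Gm: "linear_map_on scale scale\<^sub>m (dom A) G\<^sub>m"
    and Gp: "linear_map_on scale scale\<^sub>p (dom A) G\<^sub>p"
    using assms(6) unfolding boundary_quadruple_def Let_def assms(5)[symmetric] by blast+
  show ?thesis
  proof
    assume "\<exists>\<Phi>. unitary_operator scale\<^sub>m scale\<^sub>p \<Phi> \<and> B = boundary_restriction A G\<^sub>m G\<^sub>p \<Phi>"
    then obtain \<Phi> where \<Phi>: "unitary_operator scale\<^sub>m scale\<^sub>p \<Phi>"
      and B: "B = boundary_restriction A G\<^sub>m G\<^sub>p \<Phi>" by blast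
    have dom_B: "dom B = {w \<in> dom A. \<Phi> (G\<^sub>m w) = G\<^sub>p w}"
      unfolding B boundary_restriction_def by (auto simp: restrict_map_def split: if_splits)
    have B_A: "the (B x) = the (A x)" if "x \<in> dom B" for x
      using that unfolding dom_B by (simp add: B boundary_restriction_def)
    interpret A: skew_adjoint "re_form ip" "dom B" "\<lambda>u. the (A u)"
      unfolding dom_B using \<Phi>
      by (intro Q.skew_adjoint_of_isometry linear_real_of_scale[OF pre]) (auto simp: unitary_operator_def)
    have "skew_adjoint (re_form ip) (dom B) (\<lambda>x. the (B x))"
    proof (intro skew_adjoint.intro skew_adjoint_axioms.intro V.real_hilbert_form_re_form A.dense)
      show "re_form ip (the (B x)) y + re_form ip x (the (B y)) = 0" if "x \<in> dom B" "y \<in> dom B" for x y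
        using A.skew[OF that] unfolding B_A[OF that(1)] B_A[OF that(2)] .
      show "v \<in> dom B \<and> the (B v) = g"
        if "\<And>u. u \<in> dom B \<Longrightarrow> re_form ip (the (B u)) v + re_form ip u g = 0" for v g
      proof -
        have "v \<in> dom B \<and> the (A v) = g"
          using that B_A by (intro A.maximal) metis
        then show ?thesis using B_A by metis
      qed
    qed
    then show "generates_unitary_c0_group scale B"
      by (rule generates_of_skew_adjoint[OF assms(1,7)])
  next
    assume "generates_unitary_c0_group scale B"
    then obtain U where U: "c0_group scale U" "\<And>t. unitary_operator scale scale (U t)"
      and B: "B = generator U"
      unfolding generates_unitary_c0_group_def by blast
    interpret U: unitary_group "re_form ip" U
      by (rule unitary_group_of_c0_group[OF assms(1) U])
    define S where "S = dom B"
    have A\<^sub>0_B: "B u = A\<^sub>0 u" if "u \<in> dom A\<^sub>0" for u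
      using assms(8) that by (simp add: map_le_def)
    \<comment> \<open>The generator is skew and extends \<open>A\<^sub>0\<close>, so every pair in
      its graph satisfies the identity that defines the graph of \<open>A\<close>.\<close>
    have B_A: "A x = B x" if "x \<in> S" for x
    proof -
      obtain y where y: "B x = Some y" using \<open>x \<in> S\<close> by (auto simp: S_def)
      have "x \<in> dom A \<and> the (A x) = y"
      proof (rule Q.D_A)
        fix u assume "u \<in> dom A\<^sub>0"
        then have "B u = Some (the (A\<^sub>0 u))" using A\<^sub>0_B by fastforce
        then show "re_form ip (the (A\<^sub>0 u)) x + re_form ip u y = 0"
          using y unfolding B by (rule U.generator_skew)
      qed
      then show ?thesis using y by auto
    qed
    have S_A: "S \<subseteq> dom A" using B_A by (auto simp: S_def dom_def)
    have S: "subspace S" "\<And>c x. x \<in> S \<Longrightarrow> scale c x \<in> S"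
      using linear_map_on_real(1)[OF V V] assms(7) V.subspace_scale
      by (auto simp: S_def linear_operator_def linear_map_on_def)
    have neutral: "re_form ip\<^sub>p (G\<^sub>p u) (G\<^sub>p v) = re_form ip\<^sub>m (G\<^sub>m u) (G\<^sub>m v)" if "u \<in> S" "v \<in> S" for u v
    proof -
      obtain a b where ab: "B u = Some a" "B v = Some b" using \<open>u \<in> S\<close> \<open>v \<in> S\<close> by (auto simp: S_def)
      have "re_form ip a v + re_form ip u b = 0"
        using ab unfolding B by (rule U.generator_skew)
      then show ?thesis
        using Q.green[of u v] S_A that B_A[OF that(1)] B_A[OF that(2)] ab by auto
    qed
    \<comment> \<open>Green's identity rewrites the boundary condition on \<open>v\<close> as
      skew-orthogonality of \<open>(v, A v)\<close> to the graph of the generator.\<close>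
    have maximal: "v \<in> S"
      if v: "v \<in> dom A" "\<And>u. u \<in> S \<Longrightarrow> re_form ip\<^sub>p (G\<^sub>p u) (G\<^sub>p v) = re_form ip\<^sub>m (G\<^sub>m u) (G\<^sub>m v)" for v
    proof -
      have "dom A\<^sub>0 \<subseteq> dom (generator U)"
        using A\<^sub>0_B unfolding B by (auto simp: dom_def)
      then have "closure (dom (generator U)) = UNIV"
        using closure_mono Q.D\<^sub>0_dense by blast
      then have "generator U v = Some (the (A v))"
      proof (rule U.generator_maximal)
        fix u b assume "generator U u = Some b"
        then have u: "u \<in> S" "B u = Some b" by (auto simp: S_def B)
        then show "re_form ip b v + re_form ip u (the (A v)) = 0"
          using Q.green[of u v] v S_A B_A[OF u(1)] by auto
      qed
      then show ?thesis by (auto simp: S_def B)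
    qed
    have surj: "G\<^sub>m ` S = UNIV" "G\<^sub>p ` S = UNIV"
      using Q.boundary_surj_of_hypermaximal[OF S(1) S_A neutral maximal] by blast+
    have isometry: "norm (G\<^sub>p u) = norm (G\<^sub>m u)" if "u \<in> S" for u
      using neutral[OF that that] by (simp add: Q.P.ip_self Q.M.ip_self)
    \<comment> \<open>The choice is immaterial: two candidates differ by an element of
      \<open>S\<close> on which \<open>G\<^sub>m\<close> vanishes, hence by isometry
      \<open>G\<^sub>p\<close> as well.\<close>
    define \<Phi> where "\<Phi> a = G\<^sub>p (SOME u. u \<in> S \<and> G\<^sub>m u = a)" for a
    have \<Phi>: "\<Phi> (G\<^sub>m u) = G\<^sub>p u" if "u \<in> S" for u
    proof -
      define w where "w = (SOME w. w \<in> S \<and> G\<^sub>m w = G\<^sub>m u)"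
      have "w \<in> S \<and> G\<^sub>m w = G\<^sub>m u"
        unfolding w_def by (rule someI[of _ u]) (simp add: that)
      then have w: "w \<in> S" "G\<^sub>m w = G\<^sub>m u" by simp_all
      have "norm (G\<^sub>p (w - u)) = norm (G\<^sub>m (w - u))"
        using w that S(1) by (intro isometry subspace_diff)
      moreover have "w \<in> dom A" "u \<in> dom A" using w that S_A by auto
      ultimately have "norm (G\<^sub>p w - G\<^sub>p u) = 0"
        using Q.diff_D(3,4) w(2) by simp
      then show ?thesis by (simp add: \<Phi>_def w_def)
    qed
    have "unitary_operator scale\<^sub>m scale\<^sub>p \<Phi>"
      unfolding unitary_operator_def
    proof (intro conjI allI linear_scaleI[OF pre])
      show "\<Phi> (x + y) = \<Phi> x + \<Phi> y" for x y
      proof -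
        obtain u v where u: "u \<in> S" "x = G\<^sub>m u" and v: "v \<in> S" "y = G\<^sub>m v"
          using surj(1) by (metis UNIV_I imageE)
        then have "u \<in> dom A" "v \<in> dom A" using S_A by auto
        then show ?thesis
          using \<Phi>[OF subspace_add[OF S(1) u(1) v(1)]] \<Phi>[OF u(1)] \<Phi>[OF v(1)]
          by (simp add: u(2) v(2) Q.G\<^sub>m_add Q.G\<^sub>p_add)
      qed
      show "\<Phi> (scale\<^sub>m c x) = scale\<^sub>p c (\<Phi> x)" for c x
      proof -
        obtain u where u: "u \<in> S" "x = G\<^sub>m u" using surj(1) by (metis UNIV_I imageE)
        then have "u \<in> dom A" using S_A by auto
        then show ?thesis
          using \<Phi>[OF S(2)[OF u(1), of c]] \<Phi>[OF u(1)] Gm Gp by (simp add: u(2) linear_map_on_def)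
      qed
      show "surj \<Phi>" using \<Phi> surj(2) by (metis UNIV_I imageE surj_def)
      show "norm (\<Phi> x) = norm x" for x
      proof -
        obtain u where "u \<in> S" "x = G\<^sub>m u" using surj(1) by (metis UNIV_I imageE)
        then show ?thesis using \<Phi>[of u] isometry[of u] by simp
      qed
    qed
    moreover have "B = boundary_restriction A G\<^sub>m G\<^sub>p \<Phi>"
    proof
      fix w
      have "w \<in> S \<longleftrightarrow> w \<in> dom A \<and> \<Phi> (G\<^sub>m w) = G\<^sub>p w"
      proof
        assume "w \<in> S"
        then show "w \<in> dom A \<and> \<Phi> (G\<^sub>m w) = G\<^sub>p w" using \<Phi> S_A by blast
      next
        assume w: "w \<in> dom A \<and> \<Phi> (G\<^sub>m w) = G\<^sub>p w"
        \<comment> \<open>Some \<open>u\<close> in \<open>S\<close> has the same pair of boundary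
          values as \<open>w\<close>. Neutrality involves boundary values only, so \<open>w\<close>
          inherits it and maximality applies.\<close>
        obtain u where u: "u \<in> S" "G\<^sub>m w = G\<^sub>m u" using surj(1) by (metis UNIV_I imageE)
        then have "G\<^sub>p w = G\<^sub>p u" using \<Phi>[of u] w by simp
        with u w show "w \<in> S" using neutral by (intro maximal) simp_all
      qed
      then show "B w = boundary_restriction A G\<^sub>m G\<^sub>p \<Phi> w"
        using B_A[of w] by (auto simp: boundary_restriction_def restrict_map_def S_def domIff)
    qed
    ultimately show "\<exists>\<Phi>. unitary_operator scale\<^sub>m scale\<^sub>p \<Phi> \<and> B = boundary_restriction A G\<^sub>m G\<^sub>p \<Phi>"
      by blast
  qed
qed

end
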